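(* Let $H$ be an infinite-dimensional separable complex Hilbert space, let $T\in\beta_0(H)$ and let $K\in\mathcal{B}(H)$ be compact. Let $c:=\inf\sigma_p(|T|)$, $D:=T^*T-c^2I$, $R:=T^*K+K^*T+K^*K$ and $L:=D+R$. Suppose that $D$ is compact. Then $T+K\in\beta_0(H)$ if and only if $\sigma_p(L)\cap(-\infty,0)$ is finite.
   Context: $\mathcal{B}(H)$ is the algebra of bounded linear operators on $H$. A closed subspace $M\subseteq H$ is reducing for $T\in\mathcal{B}(H)$ if $TM\subseteq M$ and $TM^\perp\subseteq M^\perp$; $\mathcal{R}_T$ denotes the collection of all reducing subspaces of $T$. For $M\in\mathcal{R}_T$ non-zero, the restriction $T|_M$ is norm attaining if there is a unit vector $x\in M$ with $\|Tx\|=\|T|_M\|$, where $\|T|_M\|=\sup\{\|Ty\|:y\in M,\|y\|=1\}$. Put $|T|:=(T^*T)^{1/2}$ and $$\beta(H):=\{T\in\mathcal{B}(H): T|_M \text{ is norm attaining for every non-zero } M\in\mathcal{R}_T\},\qquad \beta_0(H):=\{T\in\mathcal{B}(H): |T|\in\beta(H)\}.$$ For $S\in\mathcal{B}(H)$, $\sigma_p(S)$ is the set of eigenvalues of $S$ (the $\lambda\in\mathbb{C}$ with $S-\lambda I$ not injective). (For $T\in\beta_0(H)$ the operator $|T|$ has eigenvalues, so $c$ is a well-defined non-negative real number; $c$ need not be an eigenvalue.) *)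

theory Defs
  imports "HOL-Analysis.Analysis"
begin

section \<open>Complex Hilbert spaces\<close>

text \<open>
  The complex inner product is linear in its first argument.  The real inner product \<open>inner\<close>
  inherited from \<^class>\<open>real_inner\<close> is its real part, so that the norm, metric and topology of the
  library are those induced by \<open>cinner\<close>: \<open>norm x = sqrt (Re (cinner x x))\<close>.
\<close>

class complex_hilbert_space = real_inner + complete_space +
  fixes scaleC :: "complex \<Rightarrow> 'a \<Rightarrow> 'a"  (infixr \<open>*\<^sub>C\<close> 75)
    and cinner :: "'a \<Rightarrow> 'a \<Rightarrow> complex"
  assumes scaleC_add_right: "a *\<^sub>C (x + y) = a *\<^sub>C x + a *\<^sub>C y"
    and scaleC_add_left: "(a + b) *\<^sub>C x = a *\<^sub>C x + b *\<^sub>C x"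
    and scaleC_scaleC: "a *\<^sub>C b *\<^sub>C x = (a * b) *\<^sub>C x"
    and scaleR_eq_scaleC: "r *\<^sub>R x = complex_of_real r *\<^sub>C x"
    and cinner_commute: "cinner x y = cnj (cinner y x)"
    and cinner_add_left: "cinner (x + y) z = cinner x z + cinner y z"
    and cinner_scaleC_left: "cinner (a *\<^sub>C x) y = a * cinner x y"
    and inner_eq_Re_cinner: "inner x y = Re (cinner x y)"

global_interpretation complex_vector:
    vector_space "scaleC :: complex \<Rightarrow> 'a \<Rightarrow> 'a::complex_hilbert_space"
  defines csubspace = complex_vector.subspace
    and cspan = complex_vector.span
proof unfold_locales
  show "1 *\<^sub>C x = x" for x :: 'a
    using scaleR_eq_scaleC[of 1 x] by simp
qed (rule scaleC_add_right scaleC_add_left scaleC_scaleC)+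

section \<open>Bounded operators\<close>

definition bounded_operators :: "('a::complex_hilbert_space \<Rightarrow> 'a) set" where
  "bounded_operators =
     {T. Vector_Spaces.linear scaleC scaleC T \<and> (\<exists>B. \<forall>x. norm (T x) \<le> B * norm x)}"

text \<open>
  The descriptions below have a unique solution for bounded \<open>T\<close> and for positive \<open>P\<close>,
  respectively, by completeness of the space.
\<close>

definition cadjoint :: "('a::complex_hilbert_space \<Rightarrow> 'a) \<Rightarrow> 'a \<Rightarrow> 'a" where
  "cadjoint T = (THE S. S \<in> bounded_operators \<and> (\<forall>x y. cinner (T x) y = cinner x (S y)))"

definition positive_operator :: "('a::complex_hilbert_space \<Rightarrow> 'a) \<Rightarrow> bool" where
  "positive_operator S \<longleftrightarrow>
     S \<in> bounded_operators \<and> (\<forall>x. cinner (S x) x \<in> \<real> \<and> 0 \<le> Re (cinner (S x) x))"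

definition sqrt_operator :: "('a::complex_hilbert_space \<Rightarrow> 'a) \<Rightarrow> 'a \<Rightarrow> 'a" where
  "sqrt_operator P = (THE S. positive_operator S \<and> S \<circ> S = P)"

definition abs_operator :: "('a::complex_hilbert_space \<Rightarrow> 'a) \<Rightarrow> 'a \<Rightarrow> 'a" where
  "abs_operator T = sqrt_operator (cadjoint T \<circ> T)"

definition compact_operator :: "('a::complex_hilbert_space \<Rightarrow> 'a) \<Rightarrow> bool" where
  "compact_operator K \<longleftrightarrow> K \<in> bounded_operators \<and> compact (closure (K ` cball 0 1))"

definition point_spectrum :: "('a::complex_hilbert_space \<Rightarrow> 'a) \<Rightarrow> complex set" where
  "point_spectrum S = {\<mu>. \<not> inj (\<lambda>x. S x - \<mu> *\<^sub>C x)}"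

section \<open>Reducing subspaces and norm attainment\<close>

definition orth_complement :: "'a::complex_hilbert_space set \<Rightarrow> 'a set" where
  "orth_complement M = {x. \<forall>y\<in>M. cinner x y = 0}"

definition reducing_subspaces :: "('a::complex_hilbert_space \<Rightarrow> 'a) \<Rightarrow> 'a set set" where
  "reducing_subspaces T =
     {M. csubspace M \<and> closed M \<and> T ` M \<subseteq> M \<and> T ` orth_complement M \<subseteq> orth_complement M}"

definition restriction_norm :: "('a::complex_hilbert_space \<Rightarrow> 'a) \<Rightarrow> 'a set \<Rightarrow> real" where
  "restriction_norm T M = (SUP y \<in> {y \<in> M. norm y = 1}. norm (T y))"

definition norm_attaining_on :: "('a::complex_hilbert_space \<Rightarrow> 'a) \<Rightarrow> 'a set \<Rightarrow> bool" where
  "norm_attaining_on T M \<longleftrightarrow> (\<exists>x\<in>M. norm x = 1 \<and> norm (T x) = restriction_norm T M)"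

definition beta :: "('a::complex_hilbert_space \<Rightarrow> 'a) set" where
  "beta = {T \<in> bounded_operators. \<forall>M \<in> reducing_subspaces T. M \<noteq> {0} \<longrightarrow> norm_attaining_on T M}"

definition beta0 :: "('a::complex_hilbert_space \<Rightarrow> 'a) set" where
  "beta0 = {T \<in> bounded_operators. abs_operator T \<in> beta}"

end

theory Submission
  imports Defs
begin

text \<open>
  Write \<open>A = T + K\<close> and \<open>S = \<bar>A\<bar>\<close>.  Expanding \<open>A\<^sup>*A\<close> gives \<open>S\<^sup>2 = c\<^sup>2 + L\<close>, where \<open>L\<close> is selfadjoint and
  compact, because \<open>D\<close> and \<open>K\<close> are compact and so is the adjoint of \<open>K\<close>.  From
  \<open>\<parallel>S x\<parallel>\<^sup>2 = c\<^sup>2 \<parallel>x\<parallel>\<^sup>2 + \<langle>L x, x\<rangle>\<close> it follows that \<open>S\<close> attains its norm on a subspace \<open>M\<close> exactly if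
  the quadratic form of \<open>L\<close> attains its maximum over the unit vectors of \<open>M\<close>.  So the theorem becomes a
  statement about one compact selfadjoint operator: its form has a maximum on every non-zero reducing
  subspace of \<open>S\<close> if and only if it has finitely many negative eigenvalues
  (\<open>beta_iff_finite_negative_eigenvalues\<close>).

  A supremum of the form over an invariant closed subspace \<open>M\<close> is attained whenever it is not \<open>0\<close>: a
  maximising sequence consists of approximate eigenvectors, and compactness makes a subsequence converge
  (\<open>form_supremum_attained\<close>).  If no maximum exists, the form is therefore strictly negative on
  \<open>M - {0}\<close>, and its minimum is a negative eigenvalue.  Splitting off the corresponding eigenspace lowers
  the number of negative eigenvalues, so that induction on this number settles one direction
  (\<open>form_maximum_attained\<close>).

  Conversely, infinitely many negative eigenvalues must accumulate at \<open>0\<close>.  Let \<open>M\<close> be the double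
  orthogonal complement of the set \<open>E\<close> of their eigenvectors.  A maximiser of the form on \<open>M\<close> would be an
  eigenvector with a non-negative eigenvalue, hence orthogonal to \<open>E\<close> and to itself.

  Most of the argument uses only the real inner product, that is, the real part of the complex one.  A
  complex linear operator is one that commutes with all scalars, and the adjoint and the square root
  inherit this property from the operator they are built from.
\<close>

section \<open>Orthogonal projections and the Riesz representation\<close>

text \<open>
  The parallelogram law, applied to \<open>x - y m\<close> and \<open>x - y n\<close>: the midpoint of \<open>y m\<close> and \<open>y n\<close> is
  again in \<open>M\<close>, so it is no closer to \<open>x\<close> than \<open>d\<close>, and this bounds the distance of the two.
\<close>

lemma minimising_sequence_Cauchy:
  fixes y :: "nat \<Rightarrow> 'h::real_inner"
  assumes M: "convex M" and y: "\<And>n. y n \<in> M"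
    and lb: "\<And>z. z \<in> M \<Longrightarrow> d \<le> norm (x - z)"
    and lim: "(\<lambda>n. norm (x - y n)) \<longlonglongrightarrow> d" and d: "0 \<le> d"
  shows "Cauchy y"
proof -
  have sq: "norm (y m - y n) ^ 2 \<le> 2 * (norm (x - y m))^2 + 2 * (norm (x - y n))^2 - 4 * d^2" for m n
  proof -
    let ?z = "(1/2) *\<^sub>R y m + (1/2) *\<^sub>R y n"
    have "?z \<in> M"
      by (rule convexD[OF M y y]) auto
    then have "d^2 \<le> norm (x - ?z) ^ 2"
      using lb d by (intro power_mono) auto
    moreover have "norm (y m - y n) ^ 2 + 4 * norm (x - ?z) ^ 2 = 2 * (norm (x - y m))^2 + 2 * (norm (x - y n))^2"
      unfolding power2_norm_eq_inner
      by (simp add: inner_diff_left inner_diff_right inner_add_left inner_add_right inner_commute algebra_simps)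
    ultimately show ?thesis by linarith
  qed
  have lim2: "(\<lambda>n. norm (x - y n) ^ 2) \<longlonglongrightarrow> d^2"
    by (intro tendsto_power lim)
  show ?thesis
  proof (rule CauchyI)
    fix e :: real assume e: "0 < e"
    have "\<forall>\<^sub>F n in sequentially. norm (x - y n) ^ 2 < d^2 + e^2/4"
      by (rule order_tendstoD(2)[OF lim2]) (use e in simp)
    then obtain N where N: "\<And>n. n \<ge> N \<Longrightarrow> norm (x - y n) ^ 2 < d^2 + e^2/4"
      by (auto simp: eventually_sequentially)
    have "norm (y m - y n) < e" if "m \<ge> N" "n \<ge> N" for m n
    proof -
      have "norm (y m - y n) ^ 2 < e^2"
        using sq[of m n] N[OF that(1)] N[OF that(2)] by linarith
      then show ?thesis using e by (simp add: power_less_imp_less_base)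
    qed
    then show "\<exists>N. \<forall>m\<ge>N. \<forall>n\<ge>N. norm (y m - y n) < e" by blast
  qed
qed

lemma nearest_point_exists:
  fixes x :: "'h::{real_inner, complete_space}"
  assumes M: "convex M" "closed M" "M \<noteq> {}"
  shows "\<exists>p\<in>M. \<forall>z\<in>M. norm (x - p) \<le> norm (x - z)"
proof -
  define d where "d = (INF z\<in>M. norm (x - z))"
  have bdd: "bdd_below ((\<lambda>z. norm (x - z)) ` M)"
    by (auto intro!: bdd_belowI[of _ 0])
  have lb: "d \<le> norm (x - z)" if "z \<in> M" for z
    unfolding d_def by (rule cINF_lower[OF bdd that])
  have d0: "0 \<le> d"
    unfolding d_def by (rule cINF_greatest) (use M in auto)
  have "\<exists>z\<in>M. norm (x - z) < d + 1 / real (Suc n)" for n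
    using cINF_less_iff[OF M(3) bdd, of "d + 1 / real (Suc n)"] by (auto simp: d_def)
  then obtain y where y: "\<And>n. y n \<in> M" "\<And>n. norm (x - y n) < d + 1 / real (Suc n)"
    by metis
  have lim: "(\<lambda>n. norm (x - y n)) \<longlonglongrightarrow> d"
  proof (rule tendsto_sandwich[OF _ _ tendsto_const])
    show "(\<lambda>n. d + 1 / real (Suc n)) \<longlonglongrightarrow> d"
      using tendsto_add[OF tendsto_const[of d] LIMSEQ_Suc[OF lim_1_over_n]] by simp
    show "\<forall>\<^sub>F n in sequentially. norm (x - y n) \<le> d + 1 / real (Suc n)"
      by (intro always_eventually allI less_imp_le y)
  qed (simp add: lb y)
  have "Cauchy y" by (rule minimising_sequence_Cauchy[OF M(1) y(1) lb lim d0])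
  then obtain p where p: "y \<longlonglongrightarrow> p" using Cauchy_convergent convergent_def by blast
  have "p \<in> M" by (rule closed_sequentially[OF M(2) _ p]) (rule y(1))
  moreover have "norm (x - p) = d"
    by (rule LIMSEQ_unique[OF _ lim]) (intro tendsto_intros p)
  ultimately show ?thesis using lb by blast
qed

text \<open>
  The nearest point \<open>p\<close> works: moving from \<open>p\<close> along \<open>z\<close> by the amount that minimises the distance
  would shorten \<open>x - p\<close> unless it is orthogonal to \<open>z\<close>.
\<close>

lemma orthogonal_projection_exists:
  fixes x :: "'h::{real_inner, complete_space}"
  assumes M: "subspace M" "closed M"
  shows "\<exists>p\<in>M. \<forall>z\<in>M. (x - p) \<bullet> z = 0"
proof -
  obtain p where p: "p \<in> M" "\<And>z. z \<in> M \<Longrightarrow> norm (x - p) \<le> norm (x - z)"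
    using nearest_point_exists[OF subspace_imp_convex M(2), of x] M subspace_0 by blast
  have "(x - p) \<bullet> z = 0" if z: "z \<in> M" for z
  proof (cases "z = 0")
    case False
    \<comment> \<open>The minimiser of \<open>t \<mapsto> \<parallel>(x - p) - t z\<parallel>\<^sup>2\<close>.\<close>
    define t where "t = ((x - p) \<bullet> z) / (z \<bullet> z)"
    have zz: "z \<bullet> z > 0" using False by simp
    have "p + t *\<^sub>R z \<in> M" using M(1) p(1) z by (simp add: subspace_add subspace_scale)
    then have "norm (x - p) ^ 2 \<le> norm ((x - p) - t *\<^sub>R z) ^ 2"
      using p(2)[of "p + t *\<^sub>R z"] by (intro power_mono) (auto simp: algebra_simps)
    also have "\<dots> = norm (x - p) ^ 2 - 2 * t * ((x - p) \<bullet> z) + t^2 * (z \<bullet> z)"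
      unfolding power2_norm_eq_inner
      by (simp add: inner_diff_left inner_diff_right inner_commute algebra_simps power2_eq_square)
    also have "\<dots> = norm (x - p) ^ 2 - ((x - p) \<bullet> z)^2 / (z \<bullet> z)"
      using zz by (simp add: t_def field_simps power2_eq_square)
    finally have "((x - p) \<bullet> z)^2 / (z \<bullet> z) \<le> 0" by simp
    then show ?thesis using zz by (simp add: divide_le_0_iff)
  qed simp
  with p(1) show ?thesis by blast
qed

text \<open>
  The representing vector spans the orthogonal complement of the kernel of \<open>f\<close>.
\<close>

lemma riesz_representation:
  fixes f :: "'h::{real_inner, complete_space} \<Rightarrow> real"
  assumes f: "bounded_linear f"
  shows "\<exists>z. \<forall>x. f x = x \<bullet> z"
proof (cases "\<forall>x. f x = 0")
  case True
  then show ?thesis by (intro exI[of _ 0]) simp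
next
  case False
  interpret f: bounded_linear f by (rule f)
  from False obtain u where u: "f u \<noteq> 0" by blast
  let ?M = "{x. f x = 0}"
  have "subspace ?M" by (auto simp: subspace_def f.add f.scaleR f.zero)
  moreover have "closed ?M" by (intro closed_Collect_eq continuous_intros f.continuous_on)
  ultimately obtain p where p: "f p = 0" "\<And>z. f z = 0 \<Longrightarrow> (u - p) \<bullet> z = 0"
    using orthogonal_projection_exists[of ?M u] by auto
  define w where "w = u - p"
  have fw: "f w \<noteq> 0" using u p(1) by (simp add: w_def f.diff)
  then have w0: "w \<bullet> w \<noteq> 0" using f.zero by force
  have "f x = x \<bullet> ((f w / (w \<bullet> w)) *\<^sub>R w)" for x
  proof -
    have "w \<bullet> (x - (f x / f w) *\<^sub>R w) = 0"
      unfolding w_def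
      by (rule p(2)) (use fw in \<open>simp add: f.diff f.scaleR w_def[symmetric]\<close>)
    then have "w \<bullet> x = f x / f w * (w \<bullet> w)" by (simp add: inner_diff_right)
    then show ?thesis using fw w0 by (simp add: inner_commute field_simps)
  qed
  then show ?thesis by blast
qed

section \<open>Selfadjoint operators and their quadratic forms\<close>

definition selfadjoint :: "('h::real_inner \<Rightarrow> 'h) \<Rightarrow> bool" where
  "selfadjoint G \<longleftrightarrow> bounded_linear G \<and> (\<forall>x y. G x \<bullet> y = x \<bullet> G y)"

lemma selfadjoint_bounded_linear: "selfadjoint G \<Longrightarrow> bounded_linear G"
  by (simp add: selfadjoint_def)

lemma selfadjoint_inner: "selfadjoint G \<Longrightarrow> G x \<bullet> y = x \<bullet> G y"
  by (simp add: selfadjoint_def)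

lemma selfadjoint_shift:
  assumes G: "selfadjoint G"
  shows "selfadjoint (\<lambda>x. m *\<^sub>R x - G x)"
  unfolding selfadjoint_def
  using G by (auto simp: selfadjoint_def inner_diff_left inner_diff_right
      intro!: bounded_linear_sub bounded_linear_scaleR_right)

lemma selfadjoint_uminus:
  assumes G: "selfadjoint G"
  shows "selfadjoint (\<lambda>x. - G x)"
  using selfadjoint_shift[OF G, of 0] by simp

text \<open>
  A Cauchy-Schwarz inequality for the form of \<open>G\<close>, obtained by evaluating it at \<open>x - G x / b\<close>.  It turns
  smallness of \<open>\<langle>G x, x\<rangle>\<close> into smallness of \<open>G x\<close>, which is how (approximate) maximisers of a form are
  recognised as (approximate) eigenvectors.
\<close>

lemma positive_form_bound:
  assumes G: "selfadjoint G"
    and M: "subspace M" "G ` M \<subseteq> M" and x: "x \<in> M"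
    and pos: "\<And>z. z \<in> M \<Longrightarrow> 0 \<le> G z \<bullet> z"
    and bound: "\<And>z. z \<in> M \<Longrightarrow> G z \<bullet> z \<le> b * norm z ^ 2"
    and b: "b > 0"
  shows "norm (G x) ^ 2 \<le> b * (G x \<bullet> x)"
proof -
  interpret G: bounded_linear G using G by (rule selfadjoint_bounded_linear)
  let ?z = "x - (1/b) *\<^sub>R G x"
  have Gx: "G x \<in> M" using M x by blast
  have "0 \<le> G ?z \<bullet> ?z" using M x Gx by (intro pos) (simp add: subspace_diff subspace_scale)
  also have "\<dots> = G x \<bullet> x - 2/b * norm (G x)^2 + 1/b^2 * (G (G x) \<bullet> G x)"
    using selfadjoint_inner[OF G, of "G x" x] b
    by (simp add: G.diff G.scaleR inner_diff_left inner_diff_right power2_norm_eq_inner field_simps)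
        (simp add: power2_eq_square field_simps)
  also have "\<dots> \<le> G x \<bullet> x - 2/b * norm (G x)^2 + 1/b^2 * (b * norm (G x)^2)"
    using bound[OF Gx] by (intro add_left_mono mult_left_mono) auto
  also have "\<dots> = G x \<bullet> x - norm (G x)^2 / b"
    using b by (simp add: field_simps power2_eq_square)
  finally show ?thesis using b by (simp add: field_simps)
qed

lemma selfadjoint_form_bounds:
  assumes G: "selfadjoint G"
  obtains B where "B > 0" "\<And>x. norm (G x) \<le> B * norm x" "\<And>x. \<bar>G x \<bullet> x\<bar> \<le> B * norm x ^ 2"
proof -
  obtain B where B: "B > 0" "\<And>x. norm (G x) \<le> norm x * B"
    using bounded_linear.pos_bounded[OF selfadjoint_bounded_linear[OF G]] by blast
  have "\<bar>G x \<bullet> x\<bar> \<le> B * norm x ^ 2" for x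
  proof -
    have "\<bar>G x \<bullet> x\<bar> \<le> norm (G x) * norm x" by (rule Cauchy_Schwarz_ineq2)
    also have "\<dots> \<le> (norm x * B) * norm x" by (intro mult_right_mono B) auto
    finally show ?thesis by (simp add: power2_eq_square mult_ac)
  qed
  with B show ?thesis by (intro that[of B]) (auto simp: mult.commute)
qed

text \<open>
  The condition is stated for all \<open>y\<close> in \<open>M\<close>, in homogeneous form, rather than for unit vectors, because
  this is the version in which it gets used.
\<close>

definition maximises_form :: "('h::real_inner \<Rightarrow> 'h) \<Rightarrow> 'h set \<Rightarrow> 'h \<Rightarrow> bool" where
  "maximises_form G M x \<longleftrightarrow> x \<in> M \<and> norm x = 1 \<and> (\<forall>y\<in>M. G y \<bullet> y \<le> (G x \<bullet> x) * norm y ^ 2)"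

lemma form_bound_of_unit_bound:
  assumes G: "bounded_linear G" and M: "subspace M"
    and unit: "\<And>y. y \<in> M \<Longrightarrow> norm y = 1 \<Longrightarrow> G y \<bullet> y \<le> s"
    and y: "y \<in> M"
  shows "G y \<bullet> y \<le> s * norm y ^ 2"
proof (cases "y = 0")
  case True then show ?thesis by simp
next
  case False
  interpret G: bounded_linear G by (rule G)
  let ?u = "(1 / norm y) *\<^sub>R y"
  have "G ?u \<bullet> ?u \<le> s" using False M y by (intro unit) (auto simp: subspace_scale)
  then show ?thesis using False by (simp add: G.scaleR field_simps power2_eq_square)
qed

text \<open>
  If \<open>m\<close> is the maximum, then \<open>m - G\<close> has a non-negative form on \<open>M\<close> that vanishes at \<open>x\<close>.
\<close>

lemma maximises_form_eigenvector:
  assumes G: "selfadjoint G" and M: "subspace M" "G ` M \<subseteq> M"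
    and x: "maximises_form G M x"
  shows "G x = (G x \<bullet> x) *\<^sub>R x"
proof -
  let ?m = "G x \<bullet> x"
  let ?P = "\<lambda>z. ?m *\<^sub>R z - G z"
  have P: "selfadjoint ?P" by (rule selfadjoint_shift[OF G])
  obtain B where B: "B > 0" "\<And>x. \<bar>?P x \<bullet> x\<bar> \<le> B * norm x ^ 2"
    using selfadjoint_form_bounds[OF P] by metis
  have xM: "x \<in> M" and nx: "norm x = 1" and max: "\<And>y. y \<in> M \<Longrightarrow> G y \<bullet> y \<le> ?m * norm y ^ 2"
    using x by (auto simp: maximises_form_def)
  have "norm (?P x) ^ 2 \<le> B * (?P x \<bullet> x)"
  proof (rule positive_form_bound[OF P M(1) _ xM _ _ B(1)])
    show "?P ` M \<subseteq> M" using M by (auto simp: subspace_diff subspace_scale)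
    show "0 \<le> ?P z \<bullet> z" if "z \<in> M" for z
      using max[OF that] by (simp add: inner_diff_left power2_norm_eq_inner)
    show "?P z \<bullet> z \<le> B * norm z ^ 2" for z
      using B(2)[of z] by linarith
  qed
  also have "\<dots> = 0" using nx by (simp add: inner_diff_left norm_eq_1)
  finally show ?thesis by simp
qed

section \<open>Compact maps\<close>

text \<open>
  Sequential form of the condition that the image of the unit ball is totally bounded.  Compared with
  compactness of the closure of this image, it passes to sums, products and adjoints by choosing
  subsequences.
\<close>

definition compact_map :: "('h::real_normed_vector \<Rightarrow> 'h) \<Rightarrow> bool" where
  "compact_map G \<longleftrightarrow>
     (\<forall>x :: nat \<Rightarrow> 'h. (\<forall>n. norm (x n) \<le> 1) \<longrightarrow>
        (\<exists>r :: nat \<Rightarrow> nat. strict_mono r \<and> Cauchy (\<lambda>n. G (x (r n)))))"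

lemma compact_map_uminus:
  assumes "compact_map G"
  shows "compact_map (\<lambda>x. - G x)"
  using assms by (simp add: compact_map_def Cauchy_def dist_norm norm_minus_commute)

lemma compact_map_add:
  fixes F G :: "'h::{real_normed_vector, complete_space} \<Rightarrow> 'h"
  assumes "compact_map F" "compact_map G"
  shows "compact_map (\<lambda>x. F x + G x)"
  unfolding compact_map_def
proof (intro allI impI)
  fix x :: "nat \<Rightarrow> 'h" assume x: "\<forall>n. norm (x n) \<le> 1"
  obtain r :: "nat \<Rightarrow> nat" where r: "strict_mono r" "Cauchy (\<lambda>n. F (x (r n)))"
    using assms(1) x unfolding compact_map_def by metis
  obtain s :: "nat \<Rightarrow> nat" where s: "strict_mono s" "Cauchy (\<lambda>n. G (x (r (s n))))"
    using assms(2)[unfolded compact_map_def, rule_format, of "x \<circ> r"] x by auto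
  have "Cauchy (\<lambda>n. F (x (r (s n))))"
    using Cauchy_subseq_Cauchy[OF r(2) s(1)] by (simp add: o_def)
  then have "Cauchy (\<lambda>n. F (x ((r \<circ> s) n)) + G (x ((r \<circ> s) n)))"
    using s(2) by (simp add: Cauchy_convergent_iff convergent_add)
  then show "\<exists>r :: nat \<Rightarrow> nat. strict_mono r \<and> Cauchy (\<lambda>n. F (x (r n)) + G (x (r n)))"
    using strict_mono_o[OF r(1) s(1)] by blast
qed

lemma compact_map_compose_left:
  assumes B: "bounded_linear B" and G: "compact_map G"
  shows "compact_map (\<lambda>x. B (G x))"
  using G bounded_linear.Cauchy[OF B] unfolding compact_map_def by meson

lemma compact_map_compose_right:
  assumes G: "compact_map G" "bounded_linear G" and B: "bounded_linear B"
  shows "compact_map (\<lambda>x. G (B x))"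
  unfolding compact_map_def
proof (intro allI impI)
  interpret B: bounded_linear B by (rule B)
  interpret G: bounded_linear G by (rule G(2))
  fix x :: "nat \<Rightarrow> 'a" assume x: "\<forall>n. norm (x n) \<le> 1"
  obtain b where b: "b > 0" "\<And>x. norm (B x) \<le> norm x * b" using B.pos_bounded by blast
  have "norm ((1/b) *\<^sub>R B (x n)) \<le> 1" for n
    using b(1) order_trans[OF b(2)[of "x n"] mult_right_mono[OF x[rule_format, of n]]] by simp
  then obtain r :: "nat \<Rightarrow> nat" where r: "strict_mono r" "Cauchy (\<lambda>n. G ((1/b) *\<^sub>R B (x (r n))))"
    using G(1)[unfolded compact_map_def, rule_format, of "\<lambda>n. (1/b) *\<^sub>R B (x n)"] by auto
  have "Cauchy (\<lambda>n. b *\<^sub>R G ((1/b) *\<^sub>R B (x (r n))))"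
    by (rule bounded_linear.Cauchy[OF bounded_linear_scaleR_right r(2)])
  then show "\<exists>r :: nat \<Rightarrow> nat. strict_mono r \<and> Cauchy (\<lambda>n. G (B (x (r n))))"
    using r(1) b(1) by (auto simp: G.scaleR)
qed

text \<open>
  Schauder's theorem in a Hilbert space: \<open>\<parallel>A z\<parallel>\<^sup>2 = \<langle>K (A z), z\<rangle>\<close>, and \<open>K A\<close> is compact, so \<open>A\<close> maps some
  subsequence of a bounded sequence to a Cauchy sequence.
\<close>

lemma compact_map_adjoint:
  assumes K: "compact_map K" "bounded_linear K" and A: "bounded_linear A"
    and adj: "\<And>x y. K x \<bullet> y = x \<bullet> A y"
  shows "compact_map A"
  unfolding compact_map_def
proof (intro allI impI)
  interpret A: bounded_linear A by (rule A)
  interpret K: bounded_linear K by (rule K(2))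
  fix x :: "nat \<Rightarrow> 'a" assume x: "\<forall>n. norm (x n) \<le> 1"
  obtain r :: "nat \<Rightarrow> nat" where r: "strict_mono r" "Cauchy (\<lambda>n. K (A (x (r n))))"
    using compact_map_compose_right[OF K A] x unfolding compact_map_def by metis
  have bound: "norm (A (x m) - A (x n)) ^ 2 \<le> 2 * norm (K (A (x m)) - K (A (x n)))" for m n
  proof -
    let ?z = "x m - x n"
    have "norm (A (x m) - A (x n)) ^ 2 = K (A ?z) \<bullet> ?z"
      by (simp add: adj power2_norm_eq_inner flip: A.diff)
    also have "\<dots> \<le> norm (K (A ?z)) * norm ?z" by (rule norm_cauchy_schwarz)
    also have "\<dots> \<le> norm (K (A ?z)) * 2"
      using norm_triangle_ineq4[of "x m" "x n"] x[rule_format, of m] x[rule_format, of n]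
      by (intro mult_left_mono) auto
    finally show ?thesis by (simp add: A.diff K.diff)
  qed
  have "Cauchy (\<lambda>n. A (x (r n)))"
  proof (rule CauchyI)
    fix e :: real assume e: "0 < e"
    then have "0 < e^2 / 2" by simp
    then obtain N where N: "\<And>m n. m \<ge> N \<Longrightarrow> n \<ge> N \<Longrightarrow> norm (K (A (x (r m))) - K (A (x (r n)))) < e^2 / 2"
      using CauchyD[OF r(2)] by blast
    have "norm (A (x (r m)) - A (x (r n))) < e" if "m \<ge> N" "n \<ge> N" for m n
    proof -
      have "norm (A (x (r m)) - A (x (r n))) ^ 2 < e ^ 2"
        using bound[of "r m" "r n"] N[OF that] by linarith
      then show ?thesis using e by (simp add: power_less_imp_less_base)
    qed
    then show "\<exists>N. \<forall>m\<ge>N. \<forall>n\<ge>N. norm (A (x (r m)) - A (x (r n))) < e" by blast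
  qed
  with r(1) show "\<exists>r :: nat \<Rightarrow> nat. strict_mono r \<and> Cauchy (\<lambda>n. A (x (r n)))" by blast
qed

section \<open>Attainment of the maximum on invariant subspaces\<close>

text \<open>
  A maximising sequence \<open>y n\<close> satisfies \<open>s y n - G (y n) \<rightarrow> 0\<close>.  Along a subsequence \<open>G (y n)\<close> converges, and
  then so does \<open>y n\<close> itself, because \<open>s\<close> is not \<open>0\<close>.  For \<open>s = 0\<close> the conclusion can fail.
\<close>

lemma form_supremum_attained:
  fixes G :: "'h::{real_inner, complete_space} \<Rightarrow> 'h"
  assumes G: "selfadjoint G" and cG: "compact_map G"
    and M: "subspace M" "closed M" "G ` M \<subseteq> M"
    and bound: "\<And>y. y \<in> M \<Longrightarrow> norm y = 1 \<Longrightarrow> G y \<bullet> y \<le> s"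
    and sup: "\<And>e. e > 0 \<Longrightarrow> \<exists>y\<in>M. norm y = 1 \<and> s - e < G y \<bullet> y"
    and s: "s \<noteq> 0"
  shows "\<exists>x. maximises_form G M x"
proof -
  interpret G: bounded_linear G using G by (rule selfadjoint_bounded_linear)
  have bound': "G y \<bullet> y \<le> s * norm y ^ 2" if "y \<in> M" for y
    by (rule form_bound_of_unit_bound[OF G.bounded_linear_axioms M(1) bound that])
  have "\<exists>y\<in>M. norm y = 1 \<and> s - 1 / real (Suc n) < G y \<bullet> y" for n
    by (rule sup) simp
  then obtain y where y: "\<And>n. y n \<in> M" "\<And>n. norm (y n) = 1" "\<And>n. s - 1 / real (Suc n) < G (y n) \<bullet> y n"
    by metis
  let ?P = "\<lambda>z. s *\<^sub>R z - G z"
  have P: "selfadjoint ?P" by (rule selfadjoint_shift[OF G])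
  obtain B where B: "B > 0" "\<And>x. \<bar>?P x \<bullet> x\<bar> \<le> B * norm x ^ 2"
    using selfadjoint_form_bounds[OF P] by metis
  have Psmall: "norm (?P (y n)) ^ 2 \<le> B * (1 / real (Suc n))" for n
  proof -
    have "norm (?P (y n)) ^ 2 \<le> B * (?P (y n) \<bullet> y n)"
    proof (rule positive_form_bound[OF P M(1) _ y(1) _ _ B(1)])
      show "?P ` M \<subseteq> M" using M by (auto simp: subspace_diff subspace_scale)
      show "0 \<le> ?P z \<bullet> z" if "z \<in> M" for z
        using bound'[OF that] by (simp add: inner_diff_left power2_norm_eq_inner)
      show "?P z \<bullet> z \<le> B * norm z ^ 2" for z using B(2)[of z] by linarith
    qed
    also have "?P (y n) \<bullet> y n \<le> 1 / real (Suc n)"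
      using y(2,3)[of n] by (simp add: inner_diff_left norm_eq_1)
    finally show ?thesis using B(1) by simp
  qed
  have "(\<lambda>n. norm (?P (y n)) ^ 2) \<longlonglongrightarrow> 0"
  proof (rule tendsto_sandwich[OF _ _ tendsto_const])
    show "(\<lambda>n. B * (1 / real (Suc n))) \<longlonglongrightarrow> 0"
      using tendsto_mult[OF tendsto_const[of B] LIMSEQ_Suc[OF lim_1_over_n]] by simp
  qed (auto intro!: always_eventually Psmall[simplified])
  then have "(\<lambda>n. sqrt (norm (?P (y n)) ^ 2)) \<longlonglongrightarrow> sqrt 0" by (rule tendsto_real_sqrt)
  then have P0: "(\<lambda>n. ?P (y n)) \<longlonglongrightarrow> 0" by (simp add: tendsto_norm_zero_iff)
  obtain r where r: "strict_mono r" "Cauchy (\<lambda>n. G (y (r n)))"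
    using cG y(2) unfolding compact_map_def by (metis order_refl)
  then obtain g where g: "(\<lambda>n. G (y (r n))) \<longlonglongrightarrow> g"
    using Cauchy_convergent convergent_def by blast
  have "(\<lambda>n. (1/s) *\<^sub>R (?P (y (r n)) + G (y (r n)))) \<longlonglongrightarrow> (1/s) *\<^sub>R (0 + g)"
    using LIMSEQ_subseq_LIMSEQ[OF P0 r(1)] g by (intro tendsto_intros) (auto simp: o_def)
  then have lim: "(\<lambda>n. y (r n)) \<longlonglongrightarrow> (1/s) *\<^sub>R g" using s by simp
  define x where "x = (1/s) *\<^sub>R g"
  have lim: "(\<lambda>n. y (r n)) \<longlonglongrightarrow> x" using lim by (simp add: x_def)
  have "x \<in> M" by (rule closed_sequentially[OF M(2) _ lim]) (rule y(1))
  moreover have "norm x = 1"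
    by (rule LIMSEQ_unique[OF tendsto_norm[OF lim]]) (simp add: y)
  moreover have "G x \<bullet> x = s"
  proof -
    have "(\<lambda>n. ?P (y (r n)) \<bullet> y (r n)) \<longlonglongrightarrow> 0 \<bullet> x"
      using LIMSEQ_subseq_LIMSEQ[OF P0 r(1)] lim by (intro tendsto_intros) (auto simp: o_def)
    moreover have "(\<lambda>n. ?P (y (r n)) \<bullet> y (r n)) \<longlonglongrightarrow> ?P x \<bullet> x"
      by (intro tendsto_intros lim G.tendsto)
    ultimately have "?P x \<bullet> x = 0" using LIMSEQ_unique by fastforce
    then show ?thesis using \<open>norm x = 1\<close> by (simp add: inner_diff_left norm_eq_1)
  qed
  ultimately show ?thesis using bound' by (auto simp: maximises_form_def)
qed

text \<open>
  Without a maximiser the supremum is \<open>0\<close>, by the previous lemma, and no non-zero vector reaches it.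
\<close>

lemma form_negative_if_no_maximiser:
  fixes G :: "'h::{real_inner, complete_space} \<Rightarrow> 'h"
  assumes G: "selfadjoint G" and cG: "compact_map G"
    and M: "subspace M" "closed M" "G ` M \<subseteq> M"
    and none: "\<nexists>x. maximises_form G M x"
    and y: "y \<in> M" "y \<noteq> 0"
  shows "G y \<bullet> y < 0"
proof -
  interpret G: bounded_linear G using G by (rule selfadjoint_bounded_linear)
  obtain B where B: "\<And>x. \<bar>G x \<bullet> x\<bar> \<le> B * norm x ^ 2"
    using selfadjoint_form_bounds[OF G] by metis
  define V where "V = (\<lambda>y. G y \<bullet> y) ` {y \<in> M. norm y = 1}"
  define s where "s = Sup V"
  have V0: "V \<noteq> {}"
  proof -
    have "(1 / norm y) *\<^sub>R y \<in> {y \<in> M. norm y = 1}" using M y by (auto simp: subspace_scale)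
    then show ?thesis unfolding V_def by blast
  qed
  have bdd: "bdd_above V"
  proof (rule bdd_aboveI)
    fix v assume "v \<in> V"
    then obtain y where "v = G y \<bullet> y" "norm y = 1" by (auto simp: V_def)
    with B[of y] show "v \<le> B" by simp
  qed
  have bound: "G y \<bullet> y \<le> s" if "y \<in> M" "norm y = 1" for y
    unfolding s_def by (rule cSup_upper[OF _ bdd]) (use that in \<open>auto simp: V_def\<close>)
  have "s = 0"
  proof (rule ccontr)
    assume "s \<noteq> 0"
    have "\<exists>x. maximises_form G M x"
    proof (rule form_supremum_attained[OF G cG M(1-3) bound _ \<open>s \<noteq> 0\<close>])
      fix e :: real assume "e > 0"
      then show "\<exists>y\<in>M. norm y = 1 \<and> s - e < G y \<bullet> y"
        using less_cSup_iff[OF V0 bdd, of "s - e"] unfolding s_def V_def by auto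
    qed
    with none show False ..
  qed
  have le: "G z \<bullet> z \<le> 0 * norm z ^ 2" if "z \<in> M" for z
    by (rule form_bound_of_unit_bound[OF G.bounded_linear_axioms M(1) _ that]) (use bound \<open>s = 0\<close> in auto)
  show ?thesis
  proof (rule ccontr)
    assume "\<not> ?thesis"
    with le[OF y(1)] have 0: "G y \<bullet> y = 0" by simp
    let ?u = "(1 / norm y) *\<^sub>R y"
    have "maximises_form G M ?u"
      using M y 0 le by (auto simp: maximises_form_def G.scaleR subspace_scale)
    with none show False by blast
  qed
qed

definition negative_eigenvalues_on :: "('h::real_inner \<Rightarrow> 'h) \<Rightarrow> 'h set \<Rightarrow> real set" where
  "negative_eigenvalues_on G M = {l. l < 0 \<and> (\<exists>x\<in>M. x \<noteq> 0 \<and> G x = l *\<^sub>R x)}"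

lemma eigenvectors_orthogonal:
  assumes G: "selfadjoint G" and x: "G x = l *\<^sub>R x" and y: "G y = m *\<^sub>R y" and "l \<noteq> m"
  shows "x \<bullet> y = 0"
proof -
  have "l * (x \<bullet> y) = m * (x \<bullet> y)" using selfadjoint_inner[OF G, of x y] x y by simp
  with \<open>l \<noteq> m\<close> show ?thesis by simp
qed

text \<open>
  Suppose that there is no maximiser.  Then the form is negative on \<open>M - {0}\<close>, so the form of \<open>-G\<close> does
  have a maximiser \<open>e\<close>, which belongs to the lowest eigenvalue \<open>l < 0\<close>.  The orthogonal complement \<open>N\<close> of the
  eigenspace \<open>E\<close> of \<open>l\<close> in \<open>M\<close> is invariant and has fewer negative eigenvalues.  A maximiser on \<open>N\<close> is
  one on \<open>M\<close>, since the values of the form on \<open>E\<close> are the lowest possible ones; and if \<open>N\<close> is trivial,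
  the form is constant on the unit sphere of \<open>M = E\<close>.
\<close>

lemma form_maximum_attained:
  fixes G :: "'h::{real_inner, complete_space} \<Rightarrow> 'h"
  assumes G: "selfadjoint G" and cG: "compact_map G"
    and "subspace M" "closed M" "G ` M \<subseteq> M" "M \<noteq> {0}"
    and "finite (negative_eigenvalues_on G M)"
  shows "\<exists>x. maximises_form G M x"
  using assms(3-)
proof (induction "card (negative_eigenvalues_on G M)" arbitrary: M rule: less_induct)
  case less
  interpret G: bounded_linear G using G by (rule selfadjoint_bounded_linear)
  note M = less.prems(1-4)
  show ?case
  proof (rule ccontr)
    assume none: "\<not> ?case"
    have neg: "G y \<bullet> y < 0" if "y \<in> M" "y \<noteq> 0" for y
      by (rule form_negative_if_no_maximiser[OF G cG M(1-3) none that])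
    obtain z where z: "z \<in> M" "z \<noteq> 0" using M(4) subspace_0[OF M(1)] by blast
    have "\<exists>x. maximises_form (\<lambda>x. - G x) M x"
    proof (rule ccontr)
      assume "\<not> ?thesis"
      then have "- G z \<bullet> z < 0"
        using M subspace_neg[OF M(1)]
        by (intro form_negative_if_no_maximiser[OF selfadjoint_uminus[OF G] compact_map_uminus[OF cG]])
           (use z in auto)
      with neg[OF z] show False by simp
    qed
    then obtain e where e: "maximises_form (\<lambda>x. - G x) M e" ..
    define l where "l = G e \<bullet> e"
    have eM: "e \<in> M" and ne: "norm e = 1" using e by (auto simp: maximises_form_def)
    have l0: "l < 0" unfolding l_def using ne by (intro neg eM) auto
    have "- G e = (- G e \<bullet> e) *\<^sub>R e"
      by (rule maximises_form_eigenvector[OF selfadjoint_uminus[OF G] M(1) _ e])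
        (use M subspace_neg[OF M(1)] in auto)
    then have Ge: "G e = l *\<^sub>R e" by (simp add: l_def)
    define E where "E = {x \<in> M. G x = l *\<^sub>R x}"
    have E: "subspace E" "closed E"
    proof -
      show "subspace E" using M(1)
        by (auto simp: subspace_def E_def G.add G.scaleR G.zero scaleR_add_right)
      have "E = M \<inter> {x. G x = l *\<^sub>R x}" by (auto simp: E_def)
      moreover have "closed {x. G x = l *\<^sub>R x}"
        by (intro closed_Collect_eq continuous_intros G.continuous_on)
      ultimately show "closed E" using M(2) by auto
    qed
    define N where "N = {x \<in> M. \<forall>y\<in>E. x \<bullet> y = 0}"
    have N: "subspace N" "closed N" "G ` N \<subseteq> N"
    proof -
      show "subspace N" using M(1)
        by (auto simp: subspace_def N_def inner_add_left)
      have "N = M \<inter> (\<Inter>y\<in>E. {x. x \<bullet> y = 0})" by (auto simp: N_def)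
      moreover have "closed {x. x \<bullet> y = 0}" for y :: 'h
        by (intro closed_Collect_eq continuous_intros)
      ultimately show "closed N" using M(2) by auto
      show "G ` N \<subseteq> N" using M(3) by (auto simp: N_def E_def selfadjoint_inner[OF G])
    qed
    have split: "\<exists>a\<in>E. \<exists>b\<in>N. x = a + b" if "x \<in> M" for x
    proof -
      obtain a where a: "a \<in> E" "\<And>z. z \<in> E \<Longrightarrow> (x - a) \<bullet> z = 0"
        using orthogonal_projection_exists[OF E, of x] by blast
      moreover have "x - a \<in> N"
        using a that M(1) by (auto simp: N_def E_def subspace_diff)
      ultimately show ?thesis by (intro bexI[of _ a] bexI[of _ "x - a"]) auto
    qed
    have form_E: "G a \<bullet> a = l * norm a ^ 2" if "a \<in> E" for a
      using that by (simp add: E_def power2_norm_eq_inner)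
    show False
    proof (cases "N = {0}")
      case True
      have "maximises_form G M e"
        unfolding maximises_form_def
      proof (intro conjI ballI eM ne)
        fix y assume "y \<in> M"
        then have "y \<in> E" using split[of y] True by auto
        then show "G y \<bullet> y \<le> (G e \<bullet> e) * norm y ^ 2" using form_E by (simp add: l_def)
      qed
      with none show False by blast
    next
      case False
      have "negative_eigenvalues_on G N \<subset> negative_eigenvalues_on G M"
      proof
        show "negative_eigenvalues_on G N \<subseteq> negative_eigenvalues_on G M"
          by (auto simp: negative_eigenvalues_on_def N_def)
        have "l \<in> negative_eigenvalues_on G M"
          using l0 eM ne Ge by (auto simp: negative_eigenvalues_on_def intro!: bexI[of _ e])
        moreover have "l \<notin> negative_eigenvalues_on G N"
          by (auto simp: negative_eigenvalues_on_def N_def E_def)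
        ultimately show "negative_eigenvalues_on G N \<noteq> negative_eigenvalues_on G M" by blast
      qed
      moreover note psubset_card_mono[OF less.prems(5) this] finite_subset[OF psubset_imp_subset[OF this] less.prems(5)]
      ultimately obtain x where x: "maximises_form G N x"
        using less.hyps[OF _ N False] by blast
      define s where "s = G x \<bullet> x"
      have xN: "x \<in> N" and nx: "norm x = 1" and xmax: "\<And>y. y \<in> N \<Longrightarrow> G y \<bullet> y \<le> s * norm y ^ 2"
        using x by (auto simp: maximises_form_def s_def)
      have xM: "x \<in> M" using xN by (simp add: N_def)
      have ls: "l \<le> s"
        using e xM nx by (auto simp: maximises_form_def l_def s_def)
      have "G y \<bullet> y \<le> s * norm y ^ 2" if y: "y \<in> M" for y
      proof -
        obtain a b where ab: "a \<in> E" "b \<in> N" "y = a + b" using split[OF y] by blast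
        have orth: "b \<bullet> a = 0" "a \<bullet> b = 0" using ab by (auto simp: N_def inner_commute)
        have Ga: "G a = l *\<^sub>R a" using ab by (simp add: E_def)
        have "G y \<bullet> y = G a \<bullet> a + G b \<bullet> b"
          using orth Ga selfadjoint_inner[OF G, of b a] ab(3)
          by (simp add: G.add inner_add_left inner_add_right)
        also have "\<dots> \<le> s * norm a ^ 2 + s * norm b ^ 2"
          using form_E[OF ab(1)] xmax[OF ab(2)] mult_right_mono[OF ls, of "norm a ^ 2"] by simp
        also have "\<dots> = s * norm y ^ 2"
          using orth ab(3) by (simp add: power2_norm_eq_inner inner_add_left inner_add_right distrib_left)
        finally show ?thesis .
      qed
      then have "maximises_form G M x" using xM nx by (simp add: maximises_form_def s_def)
      with none show False by blast
    qed
  qed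
qed

text \<open>
  Otherwise there are orthonormal eigenvectors for infinitely many eigenvalues of modulus at least \<open>e\<close>, and
  their images have mutual distance at least \<open>e\<close>, which compactness forbids.
\<close>

lemma negative_eigenvalues_accumulate_at_zero:
  assumes G: "selfadjoint G" and cG: "compact_map G"
    and A: "A \<subseteq> negative_eigenvalues_on G UNIV" "infinite A" and e: "e > 0"
  shows "\<exists>l\<in>A. - e < l"
proof (rule ccontr)
  assume "\<not> ?thesis"
  then have far: "\<And>l. l \<in> A \<Longrightarrow> e \<le> - l" by force
  interpret G: bounded_linear G using G by (rule selfadjoint_bounded_linear)
  obtain f :: "nat \<Rightarrow> real" where f: "inj f" "range f \<subseteq> A"
    using infinite_countable_subset[OF A(2)] by blast
  have "\<exists>x. norm x = 1 \<and> G x = f n *\<^sub>R x" for n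
  proof -
    obtain x where "x \<noteq> 0" "G x = f n *\<^sub>R x"
      using f(2) A(1) by (fastforce simp: negative_eigenvalues_on_def)
    then show ?thesis by (intro exI[of _ "(1 / norm x) *\<^sub>R x"]) (simp add: G.scaleR)
  qed
  then obtain x where x: "\<And>n. norm (x n) = 1" "\<And>n. G (x n) = f n *\<^sub>R x n" by metis
  obtain r :: "nat \<Rightarrow> nat" where r: "strict_mono r" "Cauchy (\<lambda>n. G (x (r n)))"
    using cG x(1) unfolding compact_map_def by (metis order_refl)
  obtain N where N: "\<And>m n. m \<ge> N \<Longrightarrow> n \<ge> N \<Longrightarrow> norm (G (x (r m)) - G (x (r n))) < e"
    using CauchyD[OF r(2) e] by blast
  let ?i = "r N" and ?j = "r (Suc N)"
  have "?i \<noteq> ?j" using strict_monoD[OF r(1), of N "Suc N"] by simp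
  then have "f ?i \<noteq> f ?j" using f(1) by (auto dest: injD)
  then have orth: "x ?i \<bullet> x ?j = 0" by (rule eigenvectors_orthogonal[OF G x(2) x(2)])
  have "norm (G (x ?i) - G (x ?j)) ^ 2 = f ?i ^ 2 + f ?j ^ 2"
    unfolding power2_norm_eq_inner using orth x(1)
    by (simp add: x(2) inner_diff_left inner_diff_right norm_eq_1 inner_commute power2_eq_square)
  moreover have "e ^ 2 \<le> f ?i ^ 2"
    using far[of "f ?i"] f(2) e power_mono[of e "- f ?i" 2] by auto
  moreover have "norm (G (x ?i) - G (x ?j)) ^ 2 < e ^ 2"
    using N[of N "Suc N"] by (intro power_strict_mono) auto
  ultimately show False using zero_le_power2[of "f ?j"] by linarith
qed

section \<open>Square roots of positive operators\<close>

text \<open>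
  If \<open>1 - Y\<close> is a square root of \<open>1 - B\<close>, then \<open>Y\<close> solves \<open>2 Y = B + Y\<^sup>2\<close>.  This is the fixed point iteration
  for that equation, which goes back to Visser.
\<close>

primrec visser :: "('h::real_vector \<Rightarrow> 'h) \<Rightarrow> nat \<Rightarrow> 'h \<Rightarrow> 'h" where
  "visser B 0 = (\<lambda>x. 0)"
| "visser B (Suc n) = (\<lambda>x. (1/2) *\<^sub>R (B x + visser B n (visser B n x)))"

text \<open>
  The iteration for the scalar \<open>B = 1\<close>.  Because all iterates are polynomials in \<open>B\<close> with non-negative
  coefficients, it dominates the one for a contraction \<open>B\<close>, and so do its increments.
\<close>

primrec visser_bound :: "nat \<Rightarrow> real" where
  "visser_bound 0 = 0"
| "visser_bound (Suc n) = (1 + visser_bound n ^ 2) / 2"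

lemma visser_bound_range: "0 \<le> visser_bound n \<and> visser_bound n \<le> 1"
proof (induction n)
  case (Suc n)
  then have "visser_bound n ^ 2 \<le> 1" by (simp add: power_le_one)
  then show ?case by simp
qed simp

lemma visser_bound_mono: "visser_bound n \<le> visser_bound (Suc n)"
proof -
  have "0 \<le> (visser_bound n - 1) ^ 2" by simp
  then show ?thesis by (simp add: power2_diff)
qed

lemma visser_bounded_linear: "bounded_linear B \<Longrightarrow> bounded_linear (visser B n)"
proof (induction n)
  case (Suc n)
  then have V: "bounded_linear (visser B n)" by simp
  have "bounded_linear (\<lambda>x. visser B n (visser B n x))" by (rule bounded_linear_compose[OF V V])
  then show ?case
    using Suc.prems unfolding visser.simps
    by (intro bounded_linear_const_scaleR bounded_linear_add)
qed (simp add: bounded_linear_zero)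

lemma visser_symmetric:
  assumes "\<And>x y. B x \<bullet> y = x \<bullet> B y"
  shows "visser B n x \<bullet> y = x \<bullet> visser B n y"
proof (induction n arbitrary: x y)
  case (Suc n)
  show ?case by (simp add: inner_add_left inner_add_right assms Suc)
qed simp

lemma visser_commute:
  assumes U: "bounded_linear U" and comm: "\<And>x. U (B x) = B (U x)"
  shows "U (visser B n x) = visser B n (U x)"
proof (induction n arbitrary: x)
  case 0
  show ?case by (simp add: linear_0[OF bounded_linear.linear[OF U]])
next
  case (Suc n)
  interpret U: bounded_linear U by (rule U)
  show ?case by (simp add: U.scaleR U.add comm Suc)
qed

lemma visser_norm:
  assumes B: "\<And>x. norm (B x) \<le> norm x"
  shows "norm (visser B n x) \<le> visser_bound n * norm x"
proof (induction n arbitrary: x)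
  case (Suc n)
  have "norm (visser B n (visser B n x)) \<le> visser_bound n * (visser_bound n * norm x)"
    using Suc[of "visser B n x"] mult_left_mono[OF Suc[of x], of "visser_bound n"] visser_bound_range[of n]
    by simp
  then have "norm (B x + visser B n (visser B n x)) \<le> norm x + visser_bound n * (visser_bound n * norm x)"
    using norm_triangle_ineq[of "B x" "visser B n (visser B n x)"] B[of x] by linarith
  then show ?case by (simp add: power2_eq_square algebra_simps del: scaleR_add_right)
qed simp

text \<open>
  The iterates commute, so \<open>Z\<^sup>2 - Y\<^sup>2 = (Z - Y) (Z + Y)\<close> for consecutive iterates \<open>Y\<close> and \<open>Z\<close>; the induction
  hypothesis bounds the first factor and \<open>visser_norm\<close> the second.
\<close>

lemma visser_step:
  assumes lin: "bounded_linear B" and B: "\<And>x. norm (B x) \<le> norm x"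
  shows "norm (visser B (Suc n) x - visser B n x) \<le> (visser_bound (Suc n) - visser_bound n) * norm x"
proof (induction n arbitrary: x)
  case 0
  then show ?case using B[of x] by simp
next
  case (Suc n)
  let ?Y = "visser B n" and ?Z = "visser B (Suc n)"
  let ?q = "visser_bound n" and ?p = "visser_bound (Suc n)"
  interpret Y: bounded_linear ?Y by (rule visser_bounded_linear[OF lin])
  interpret Z: bounded_linear ?Z by (rule visser_bounded_linear[OF lin])
  have "?Y (B x) = B (?Y x)" for x by (rule visser_commute[OF lin, symmetric]) simp
  then have YZ: "?Y (?Z x) = ?Z (?Y x)" by (rule visser_commute[OF Y.bounded_linear_axioms])
  let ?w = "?Z x + ?Y x"
  have "visser B (Suc (Suc n)) x - ?Z x = (1/2) *\<^sub>R (?Z (?Z x) - ?Y (?Y x))"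
    by (subst (1) visser.simps(2), subst (4) visser.simps(2)) (simp add: algebra_simps)
  also have "\<dots> = (1/2) *\<^sub>R (?Z ?w - ?Y ?w)"
    unfolding Z.add Y.add YZ by (simp only: algebra_simps)
  finally have eq: "visser B (Suc (Suc n)) x - ?Z x = (1/2) *\<^sub>R (?Z ?w - ?Y ?w)" .
  have pq: "0 \<le> ?p - ?q" using visser_bound_mono[of n] by linarith
  have nw: "norm ?w \<le> (?p + ?q) * norm x"
    using norm_triangle_ineq[of "?Z x" "?Y x"] visser_norm[OF B, of "Suc n" x] visser_norm[OF B, of n x]
    by (simp only: distrib_right)
  have "norm (?Z ?w - ?Y ?w) \<le> (?p - ?q) * norm ?w" by (rule Suc)
  also have "\<dots> \<le> (?p - ?q) * ((?p + ?q) * norm x)" by (rule mult_left_mono[OF nw pq])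
  also have "\<dots> = 2 * ((visser_bound (Suc (Suc n)) - ?p) * norm x)"
  proof -
    have "r - p = (p ^ 2 - q ^ 2) / 2" if "r = (1 + p ^ 2) / 2" "p = (1 + q ^ 2) / 2" for p q r :: real
    proof -
      have "2 * r = 1 + p ^ 2" using that(1) by simp
      moreover have "2 * p = 1 + q ^ 2" using that(2) by simp
      ultimately show ?thesis by (simp add: field_simps)
    qed
    from this[OF visser_bound.simps(2) visser_bound.simps(2)]
    have "visser_bound (Suc (Suc n)) - ?p = (?p ^ 2 - ?q ^ 2) / 2" .
    then show ?thesis by (simp only:) (simp add: power2_eq_square algebra_simps del: visser_bound.simps)
  qed
  finally show ?case unfolding eq by simp
qed

text \<open>
  The norms of the increments are dominated by those of a convergent sequence of numbers, so the iterates
  converge.  Operators commuting with \<open>B\<close> commute with all iterates, hence with the limit; this yields both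
  complex linearity and uniqueness of the square root.
\<close>

lemma visser_limit:
  fixes B :: "'h::{real_inner, complete_space} \<Rightarrow> 'h"
  assumes B: "selfadjoint B" and contr: "\<And>x. norm (B x) \<le> norm x"
  obtains Y where "selfadjoint Y" "\<And>x. norm (Y x) \<le> norm x"
    "\<And>x. 2 *\<^sub>R Y x = B x + Y (Y x)"
    "\<And>U x. bounded_linear U \<Longrightarrow> (\<And>x. U (B x) = B (U x)) \<Longrightarrow> U (Y x) = Y (U x)"
proof -
  let ?V = "visser B" and ?q = visser_bound
  have lin: "bounded_linear B" by (rule selfadjoint_bounded_linear[OF B])
  have inc: "incseq ?q" using visser_bound_mono by (rule incseq_SucI)
  obtain q where "?q \<longlonglongrightarrow> q"
    using incseq_convergent[OF inc, of 1] visser_bound_range by metis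
  then have Cq: "Cauchy ?q" by (rule LIMSEQ_imp_Cauchy)
  have tail: "norm (?V (m + k) x - ?V m x) \<le> (?q (m + k) - ?q m) * norm x" for m k x
  proof (induction k)
    case (Suc k)
    have "norm (?V (m + Suc k) x - ?V m x) \<le>
        norm (?V (Suc (m + k)) x - ?V (m + k) x) + norm (?V (m + k) x - ?V m x)"
      using norm_triangle_ineq[of "?V (Suc (m + k)) x - ?V (m + k) x" "?V (m + k) x - ?V m x"]
      by (simp del: visser.simps)
    also have "\<dots> \<le> (?q (m + Suc k) - ?q m) * norm x"
      using Suc visser_step[OF lin contr, of "m + k" x]
      by (simp del: visser.simps visser_bound.simps add: left_diff_distrib)
    finally show ?case .
  qed simp
  have "Cauchy (\<lambda>n. ?V n x)" for x
  proof (rule CauchyI)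
    fix e :: real assume e: "0 < e"
    have "0 < e / (norm x + 1)" using e by (simp add: add_nonneg_pos)
    then obtain N where N: "\<And>m n. m \<ge> N \<Longrightarrow> n \<ge> N \<Longrightarrow> norm (?q m - ?q n) < e / (norm x + 1)"
      using CauchyD[OF Cq] by blast
    have one: "norm (?V m x - ?V n x) < e" if "n \<ge> N" "m \<ge> n" for m n
    proof -
      have "norm (?V m x - ?V n x) \<le> (?q m - ?q n) * norm x"
        using tail[of n "m - n" x] that by simp
      also have "\<dots> \<le> e / (norm x + 1) * norm x"
        using N[of m n] that by (intro mult_right_mono) auto
      also have "\<dots> < e / (norm x + 1) * (norm x + 1)"
        using \<open>0 < e / (norm x + 1)\<close> by (intro mult_strict_left_mono) auto
      also have "\<dots> = e" using add_nonneg_pos[OF norm_ge_zero[of x] zero_less_one] by simp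
      finally show ?thesis .
    qed
    show "\<exists>M. \<forall>m\<ge>M. \<forall>n\<ge>M. norm (?V m x - ?V n x) < e"
    proof (intro exI[of _ N] allI impI)
      fix m n assume "N \<le> m" "N \<le> n"
      then show "norm (?V m x - ?V n x) < e"
        using one[of n m] one[of m n] by (cases m n rule: le_cases) (auto simp: norm_minus_commute)
    qed
  qed
  then have "\<exists>l. (\<lambda>n. ?V n x) \<longlonglongrightarrow> l" for x
    by (simp add: Cauchy_convergent_iff convergent_def)
  then obtain Y where Y: "\<And>x. (\<lambda>n. ?V n x) \<longlonglongrightarrow> Y x" by metis
  have V1: "norm (?V n x) \<le> norm x" for n x
    using visser_norm[OF contr, of n x] mult_right_mono[of "?q n" 1 "norm x"] visser_bound_range[of n]
    by simp
  have Y1: "norm (Y x) \<le> norm x" for x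
    by (rule LIMSEQ_le_const2[OF tendsto_norm[OF Y]]) (use V1 in auto)
  have linY: "bounded_linear Y"
  proof (rule bounded_linear_intro[where K = 1])
    show "Y (x + y) = Y x + Y y" for x y
    proof (rule LIMSEQ_unique[OF Y])
      show "(\<lambda>n. ?V n (x + y)) \<longlonglongrightarrow> Y x + Y y"
        using tendsto_add[OF Y[of x] Y[of y]] visser_bounded_linear[OF lin]
        by (simp add: linear_add bounded_linear.linear)
    qed
    show "Y (r *\<^sub>R x) = r *\<^sub>R Y x" for r x
    proof (rule LIMSEQ_unique[OF Y])
      show "(\<lambda>n. ?V n (r *\<^sub>R x)) \<longlonglongrightarrow> r *\<^sub>R Y x"
        using tendsto_scaleR[OF tendsto_const[of r] Y[of x]] visser_bounded_linear[OF lin]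
        by (simp add: linear_cmul bounded_linear.linear)
    qed
  qed (use Y1 in simp)
  have symY: "Y x \<bullet> y = x \<bullet> Y y" for x y
  proof (rule LIMSEQ_unique)
    show "(\<lambda>n. ?V n x \<bullet> y) \<longlonglongrightarrow> Y x \<bullet> y" by (intro tendsto_intros Y)
    have "(\<lambda>n. x \<bullet> ?V n y) \<longlonglongrightarrow> x \<bullet> Y y" by (intro tendsto_intros Y)
    then show "(\<lambda>n. ?V n x \<bullet> y) \<longlonglongrightarrow> x \<bullet> Y y"
      using visser_symmetric[of B] selfadjoint_inner[OF B] by simp
  qed
  have VV: "(\<lambda>n. ?V n (?V n x)) \<longlonglongrightarrow> Y (Y x)" for x
  proof -
    have "(\<lambda>n. ?V n (?V n x - Y x)) \<longlonglongrightarrow> 0"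
    proof (rule Lim_null_comparison)
      show "\<forall>\<^sub>F n in sequentially. norm (?V n (?V n x - Y x)) \<le> norm (?V n x - Y x)"
        using V1 by (intro always_eventually allI)
      show "(\<lambda>n. norm (?V n x - Y x)) \<longlonglongrightarrow> 0"
        using tendsto_norm[OF tendsto_diff[OF Y[of x] tendsto_const[of "Y x"]]] by simp
    qed
    from tendsto_add[OF this Y[of "Y x"]] show ?thesis
      using visser_bounded_linear[OF lin] by (simp add: linear_diff bounded_linear.linear)
  qed
  have eq: "2 *\<^sub>R Y x = B x + Y (Y x)" for x
  proof (rule LIMSEQ_unique)
    show "(\<lambda>n. 2 *\<^sub>R ?V (Suc n) x) \<longlonglongrightarrow> 2 *\<^sub>R Y x"
      by (intro tendsto_intros LIMSEQ_Suc Y)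
    have "(\<lambda>n. B x + ?V n (?V n x)) \<longlonglongrightarrow> B x + Y (Y x)" by (intro tendsto_intros VV)
    then show "(\<lambda>n. 2 *\<^sub>R ?V (Suc n) x) \<longlonglongrightarrow> B x + Y (Y x)" by simp
  qed
  have comm: "U (Y x) = Y (U x)" if U: "bounded_linear U" and UB: "\<And>x. U (B x) = B (U x)" for U x
  proof (rule LIMSEQ_unique)
    show "(\<lambda>n. U (?V n x)) \<longlonglongrightarrow> U (Y x)" by (rule bounded_linear.tendsto[OF U Y])
    show "(\<lambda>n. U (?V n x)) \<longlonglongrightarrow> Y (U x)" using Y[of "U x"] visser_commute[of U B, OF U UB] by simp
  qed
  show ?thesis
    by (rule that[OF _ Y1 eq comm]) (use linY symY in \<open>auto simp: selfadjoint_def\<close>)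
qed

definition positive_selfadjoint :: "('h::real_inner \<Rightarrow> 'h) \<Rightarrow> bool" where
  "positive_selfadjoint G \<longleftrightarrow> selfadjoint G \<and> (\<forall>x. 0 \<le> G x \<bullet> x)"

text \<open>
  If \<open>b\<close> bounds the form of \<open>P\<close>, then \<open>B = 1 - P / b\<close> is a contraction with a non-negative form; the limit
  \<open>Y\<close> of the iteration satisfies \<open>(1 - Y)\<^sup>2 = 1 - B = P / b\<close>.
\<close>

lemma positive_selfadjoint_sqrt_exists:
  fixes P :: "'h::{real_inner, complete_space} \<Rightarrow> 'h"
  assumes P: "positive_selfadjoint P"
  obtains S where "positive_selfadjoint S" "\<And>x. S (S x) = P x"
    "\<And>U x. bounded_linear U \<Longrightarrow> (\<And>x. U (P x) = P (U x)) \<Longrightarrow> U (S x) = S (U x)"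
proof -
  have sP: "selfadjoint P" and pos: "\<And>x. 0 \<le> P x \<bullet> x" using P by (auto simp: positive_selfadjoint_def)
  obtain b where b: "b > 0" "\<And>x. \<bar>P x \<bullet> x\<bar> \<le> b * norm x ^ 2"
    using selfadjoint_form_bounds[OF sP] by metis
  interpret P: bounded_linear P by (rule selfadjoint_bounded_linear[OF sP])
  define B where "B = (\<lambda>x. x - (1/b) *\<^sub>R P x)"
  have "bounded_linear B" unfolding B_def
    by (intro bounded_linear_sub bounded_linear_ident bounded_linear_const_scaleR P.bounded_linear_axioms)
  then have sB: "selfadjoint B"
    using selfadjoint_inner[OF sP] by (simp add: selfadjoint_def B_def inner_diff_left inner_diff_right)
  have Bx: "B x \<bullet> x = norm x ^ 2 - (P x \<bullet> x) / b" for x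
    by (simp add: B_def inner_diff_left power2_norm_eq_inner)
  have lower: "0 \<le> B x \<bullet> x" and upper: "B x \<bullet> x \<le> 1 * norm x ^ 2" for x
    using b(1) b(2)[of x] pos[of x] by (auto simp: Bx field_simps)
  have contr: "norm (B x) \<le> norm x" for x
  proof -
    have "norm (B x) ^ 2 \<le> 1 * (B x \<bullet> x)"
      by (rule positive_form_bound[OF sB subspace_UNIV]) (use lower upper in auto)
    then have "norm (B x) ^ 2 \<le> norm x ^ 2" using upper[of x] by linarith
    then show ?thesis by (rule power2_le_imp_le) simp
  qed
  obtain Y where Y: "selfadjoint Y" "\<And>x. norm (Y x) \<le> norm x" "\<And>x. 2 *\<^sub>R Y x = B x + Y (Y x)"
    and comm: "\<And>U x. bounded_linear U \<Longrightarrow> (\<And>x. U (B x) = B (U x)) \<Longrightarrow> U (Y x) = Y (U x)"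
    using visser_limit[OF sB contr] by metis
  interpret Y: bounded_linear Y by (rule selfadjoint_bounded_linear[OF Y(1)])
  define S where "S = (\<lambda>x. sqrt b *\<^sub>R (x - Y x))"
  have "bounded_linear S" unfolding S_def
    by (intro bounded_linear_sub bounded_linear_ident bounded_linear_const_scaleR Y.bounded_linear_axioms)
  moreover have "0 \<le> S x \<bullet> x" for x
  proof -
    have "Y x \<bullet> x \<le> norm (Y x) * norm x" by (rule norm_cauchy_schwarz)
    also have "\<dots> \<le> norm x * norm x" by (intro mult_right_mono Y) auto
    finally show ?thesis using b(1)
      by (simp add: S_def inner_diff_left power2_norm_eq_inner[symmetric] power2_eq_square)
  qed
  ultimately have "positive_selfadjoint S"
    using selfadjoint_inner[OF Y(1)]
    by (simp add: positive_selfadjoint_def selfadjoint_def inner_diff_left inner_diff_right S_def)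
  moreover have "S (S x) = P x" for x
  proof -
    have "S (S x) = b *\<^sub>R (x - 2 *\<^sub>R Y x + Y (Y x))"
      using b(1) by (simp add: S_def Y.scaleR Y.diff scaleR_2 algebra_simps flip: scaleR_scaleR)
        (simp flip: scaleR_add_left)
    also have "\<dots> = P x" using b(1) by (simp add: Y(3)) (simp add: B_def)
    finally show ?thesis .
  qed
  moreover have "U (S x) = S (U x)" if U: "bounded_linear U" and UP: "\<And>x. U (P x) = P (U x)" for U x
  proof -
    interpret U: bounded_linear U by (rule U)
    have "U (B x) = B (U x)" for x by (simp add: B_def U.diff U.scaleR UP)
    then show ?thesis using comm[OF U] by (simp add: S_def U.diff U.scaleR)
  qed
  ultimately show ?thesis using that by blast
qed

lemma positive_selfadjoint_null:
  assumes S: "positive_selfadjoint S" and 0: "S y \<bullet> y = 0"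
  shows "S y = 0"
proof -
  have sS: "selfadjoint S" and pos: "\<And>x. 0 \<le> S x \<bullet> x" using S by (auto simp: positive_selfadjoint_def)
  obtain b where b: "b > 0" "\<And>x. \<bar>S x \<bullet> x\<bar> \<le> b * norm x ^ 2"
    using selfadjoint_form_bounds[OF sS] by metis
  have "norm (S y) ^ 2 \<le> b * (S y \<bullet> y)"
    by (rule positive_form_bound[OF sS subspace_UNIV _ _ pos _ b(1)]) (use b(2) in \<open>auto simp: abs_le_iff\<close>)
  with 0 show ?thesis by simp
qed

text \<open>
  For \<open>y = S x - Q x\<close> the hypotheses give \<open>(S + Q) y = 0\<close>, so both forms vanish at \<open>y\<close>, whence
  \<open>S y = Q y = 0\<close> and \<open>\<parallel>y\<parallel>\<^sup>2 = \<langle>x, S y - Q y\<rangle> = 0\<close>.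
\<close>

lemma commuting_square_roots_equal:
  assumes S: "positive_selfadjoint S" and Q: "positive_selfadjoint Q"
    and sq: "\<And>x. S (S x) = Q (Q x)" and comm: "\<And>x. S (Q x) = Q (S x)"
  shows "S = Q"
proof
  fix x
  interpret S: bounded_linear S using S by (simp add: positive_selfadjoint_def selfadjoint_def)
  interpret Q: bounded_linear Q using Q by (simp add: positive_selfadjoint_def selfadjoint_def)
  define y where "y = S x - Q x"
  have "S y + Q y = 0" by (simp add: y_def S.diff Q.diff sq comm)
  then have "S y \<bullet> y + Q y \<bullet> y = 0" by (simp flip: inner_add_left)
  moreover have "0 \<le> S y \<bullet> y" "0 \<le> Q y \<bullet> y" using S Q by (auto simp: positive_selfadjoint_def)
  ultimately have "S y = 0" "Q y = 0"
    using positive_selfadjoint_null[OF S, of y] positive_selfadjoint_null[OF Q, of y] by linarith+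
  moreover have "y \<bullet> y = x \<bullet> (S y - Q y)"
    using S Q by (simp add: y_def inner_diff_left inner_diff_right positive_selfadjoint_def selfadjoint_def S.diff Q.diff)
  ultimately show "S x = Q x" by (simp add: y_def)
qed

section \<open>Adjoints and absolute values on complex Hilbert spaces\<close>

lemma inner_scaleC_left: "(a *\<^sub>C x) \<bullet> y = x \<bullet> (cnj a *\<^sub>C y)" for x y :: "'a::complex_hilbert_space"
proof -
  have "cinner x (cnj a *\<^sub>C y) = cnj (cinner (cnj a *\<^sub>C y) x)" by (rule cinner_commute)
  also have "\<dots> = a * cnj (cinner y x)" by (simp add: cinner_scaleC_left)
  also have "\<dots> = cinner (a *\<^sub>C x) y" by (simp add: cinner_scaleC_left cinner_commute[of x y])
  finally show ?thesis by (simp add: inner_eq_Re_cinner)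
qed

text \<open>
  Together with \<open>inner_eq_Re_cinner\<close> this expresses the complex inner product by the real one.
\<close>

lemma Im_cinner: "Im (cinner x y) = x \<bullet> (\<i> *\<^sub>C y)" for x y :: "'a::complex_hilbert_space"
  using inner_scaleC_left[of "-\<i>" x y] 
  by (simp add: inner_eq_Re_cinner cinner_scaleC_left del: complex_vector.scale_minus_left)

lemma norm_scaleC: "norm (a *\<^sub>C x) = cmod a * norm x" for x :: "'a::complex_hilbert_space"
proof -
  have "norm (a *\<^sub>C x) ^ 2 = x \<bullet> ((cnj a * a) *\<^sub>C x)"
    by (simp add: power2_norm_eq_inner inner_scaleC_left scaleC_scaleC)
  also have "cnj a * a = complex_of_real (cmod a ^ 2)"
    by (simp add: complex_norm_square mult.commute flip: of_real_power)
  also have "x \<bullet> (complex_of_real (cmod a ^ 2) *\<^sub>C x) = (cmod a * norm x) ^ 2"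
    by (simp add: power_mult_distrib power2_norm_eq_inner flip: scaleR_eq_scaleC)
  finally show ?thesis by (rule power2_eq_imp_eq) auto
qed

lemma bounded_linear_scaleC: "bounded_linear (\<lambda>x. a *\<^sub>C x :: 'a::complex_hilbert_space)"
  by (rule bounded_linear_intro[where K = "cmod a"])
    (auto simp: scaleC_add_right norm_scaleC scaleR_eq_scaleC scaleC_scaleC mult.commute)

lemma csubspace_imp_subspace: "csubspace M \<Longrightarrow> subspace M"
  by (auto simp: subspace_def complex_vector.subspace_def scaleR_eq_scaleC)

lemma bounded_operators_iff:
  "T \<in> bounded_operators \<longleftrightarrow> bounded_linear T \<and> (\<forall>a x. T (a *\<^sub>C x) = a *\<^sub>C T x)"
proof
  assume "T \<in> bounded_operators"
  then obtain B where lin: "Vector_Spaces.linear scaleC scaleC T" and B: "\<And>x. norm (T x) \<le> B * norm x"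
    by (auto simp: bounded_operators_def)
  interpret T: Vector_Spaces.linear scaleC scaleC T by (rule lin)
  have "bounded_linear T"
    by (rule bounded_linear_intro[where K = B])
      (use B in \<open>auto simp: T.add T.scale scaleR_eq_scaleC mult.commute\<close>)
  then show "bounded_linear T \<and> (\<forall>a x. T (a *\<^sub>C x) = a *\<^sub>C T x)" by (simp add: T.scale)
next
  assume T: "bounded_linear T \<and> (\<forall>a x. T (a *\<^sub>C x) = a *\<^sub>C T x)"
  then interpret T: bounded_linear T by simp
  have "Vector_Spaces.linear scaleC scaleC T"
    by (intro Vector_Spaces.linear_iff[THEN iffD2] conjI complex_vector.vector_space_axioms)
      (use T in \<open>auto simp: T.add\<close>)
  moreover obtain B where "\<And>x. norm (T x) \<le> norm x * B" using T.bounded by blast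
  then have "\<exists>B. \<forall>x. norm (T x) \<le> B * norm x" by (metis mult.commute)
  ultimately show "T \<in> bounded_operators" by (simp add: bounded_operators_def)
qed

text \<open>
  For the complex linear \<open>S\<close>, the imaginary part of the left-hand condition is its real part at \<open>\<i> y\<close>.
\<close>

lemma cinner_eq_iff_inner:
  assumes "S \<in> bounded_operators"
  shows "(\<forall>x y. cinner (T x) y = cinner x (S y)) \<longleftrightarrow> (\<forall>x y. T x \<bullet> y = x \<bullet> S y)"
  using assms
  by (auto simp: complex_eq_iff Im_cinner bounded_operators_iff simp flip: inner_eq_Re_cinner)

text \<open>
  The values of the adjoint come from the Riesz representation.  As they are unique, the adjoint inherits
  linearity from the inner product, and from \<open>T\<close> that it commutes with complex scalars.
\<close>

lemma adjoint_exists: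
  fixes T :: "'a::complex_hilbert_space \<Rightarrow> 'a"
  assumes T: "T \<in> bounded_operators"
  shows "\<exists>S\<in>bounded_operators. \<forall>x y. T x \<bullet> y = x \<bullet> S y"
proof -
  interpret T: bounded_linear T using T by (simp add: bounded_operators_iff)
  have "\<exists>z. \<forall>x. T x \<bullet> y = x \<bullet> z" for y
    by (rule riesz_representation) (rule bounded_linear_inner_left_comp[OF T.bounded_linear_axioms])
  then obtain S where S: "\<And>x y. T x \<bullet> y = x \<bullet> S y" by metis
  have eqI: "u = v" if "\<And>x. x \<bullet> u = x \<bullet> v" for u v :: 'a
    using that vector_eq_ldot by blast
  obtain B where B: "0 < B" "\<And>x. norm (T x) \<le> norm x * B" using T.pos_bounded by blast
  have "bounded_linear S"
  proof (rule bounded_linear_intro[where K = B])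
    show "S (x + y) = S x + S y" for x y by (rule eqI) (simp add: inner_add_right flip: S)
    show "S (r *\<^sub>R x) = r *\<^sub>R S x" for r x by (rule eqI) (simp flip: S)
    show "norm (S x) \<le> norm x * B" for x
    proof (cases "S x = 0")
      case False
      have "norm (S x) * norm (S x) = T (S x) \<bullet> x"
        by (simp add: S power2_norm_eq_inner[symmetric] power2_eq_square)
      also have "\<dots> \<le> norm (T (S x)) * norm x" by (rule norm_cauchy_schwarz)
      also have "\<dots> \<le> (norm (S x) * B) * norm x" by (intro mult_right_mono B) auto
      finally show ?thesis using False by (simp add: mult_ac)
    qed (use B in simp)
  qed
  moreover have "S (a *\<^sub>C y) = a *\<^sub>C S y" for a y
  proof (rule eqI)
    fix x
    have "x \<bullet> S (a *\<^sub>C y) = T (cnj a *\<^sub>C x) \<bullet> y"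
      using T by (simp add: bounded_operators_iff inner_scaleC_left flip: S)
    then show "x \<bullet> S (a *\<^sub>C y) = x \<bullet> (a *\<^sub>C S y)" by (simp add: S inner_scaleC_left)
  qed
  ultimately show ?thesis using S by (intro bexI[of _ S]) (auto simp: bounded_operators_iff)
qed

lemma cadjoint_properties:
  fixes T :: "'a::complex_hilbert_space \<Rightarrow> 'a"
  assumes T: "T \<in> bounded_operators"
  shows cadjoint_bounded: "cadjoint T \<in> bounded_operators"
    and cadjoint_inner: "T x \<bullet> y = x \<bullet> cadjoint T y"
proof -
  let ?Q = "\<lambda>S. S \<in> bounded_operators \<and> (\<forall>x y. cinner (T x) y = cinner x (S y))"
  have iff: "?Q S \<longleftrightarrow> S \<in> bounded_operators \<and> (\<forall>x y. T x \<bullet> y = x \<bullet> S y)" for S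
    using cinner_eq_iff_inner[of S T] by blast
  have "\<exists>!S. ?Q S"
  proof -
    obtain S where S: "S \<in> bounded_operators" "\<And>x y. T x \<bullet> y = x \<bullet> S y"
      using adjoint_exists[OF T] by blast
    show ?thesis unfolding iff
    proof (rule ex1I[of _ S])
      fix S' assume S': "S' \<in> bounded_operators \<and> (\<forall>x y. T x \<bullet> y = x \<bullet> S' y)"
      have "S' y = S y" for y using S' S(2) vector_eq_ldot[of "S' y" "S y"] by metis
      then show "S' = S" by blast
    qed (use S in blast)
  qed
  then have "?Q (cadjoint T)" unfolding cadjoint_def by (rule theI')
  then show "cadjoint T \<in> bounded_operators" "T x \<bullet> y = x \<bullet> cadjoint T y"
    using iff by blast+
qed

text \<open>
  That \<open>\<langle>S x, x\<rangle>\<close> is real means \<open>S x\<close> is orthogonal to \<open>\<i> x\<close> in the real inner product; polarisation makes this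
  equivalent to symmetry of \<open>S\<close>.
\<close>

lemma positive_operator_iff:
  "positive_operator S \<longleftrightarrow> positive_selfadjoint S \<and> (\<forall>a x. S (a *\<^sub>C x) = a *\<^sub>C S x)"
proof
  assume S: "positive_operator S"
  then have lin: "bounded_linear S" and C: "\<And>a x. S (a *\<^sub>C x) = a *\<^sub>C S x"
    by (auto simp: positive_operator_def bounded_operators_iff)
  interpret S: bounded_linear S by (rule lin)
  have 0: "S x \<bullet> (\<i> *\<^sub>C x) = 0" for x
    using S by (simp add: positive_operator_def complex_is_Real_iff flip: Im_cinner)
  have "S x \<bullet> y = x \<bullet> S y" for x y
  proof -
    have "S x \<bullet> (\<i> *\<^sub>C z) + S z \<bullet> (\<i> *\<^sub>C x) = 0" for z
      using 0[of "x + z"] 0[of x] 0[of z] by (simp add: S.add scaleC_add_right inner_add_left inner_add_right)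
    from this[of "(-\<i>) *\<^sub>C y"] show ?thesis
      by (simp add: C scaleC_scaleC inner_scaleC_left inner_commute[of "S _"] del: complex_vector.scale_minus_left) simp
  qed
  then show "positive_selfadjoint S \<and> (\<forall>a x. S (a *\<^sub>C x) = a *\<^sub>C S x)"
    using lin C S by (simp add: positive_selfadjoint_def selfadjoint_def positive_operator_def inner_eq_Re_cinner)
next
  assume S: "positive_selfadjoint S \<and> (\<forall>a x. S (a *\<^sub>C x) = a *\<^sub>C S x)"
  then have sS: "selfadjoint S" and C: "\<And>a x. S (a *\<^sub>C x) = a *\<^sub>C S x" by (auto simp: positive_selfadjoint_def)
  have "S x \<bullet> (\<i> *\<^sub>C x) = 0" for x
  proof -
    have "S x \<bullet> (\<i> *\<^sub>C x) = x \<bullet> (\<i> *\<^sub>C S x)" by (simp add: selfadjoint_inner[OF sS] C)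
    also have "\<dots> = (cnj \<i> *\<^sub>C x) \<bullet> S x" by (simp add: inner_scaleC_left)
    also have "\<dots> = - (S x \<bullet> (\<i> *\<^sub>C x))"
      by (simp add: inner_commute)
    finally show ?thesis by simp
  qed
  then show "positive_operator S"
    using S unfolding positive_operator_def bounded_operators_iff positive_selfadjoint_def selfadjoint_def
      complex_is_Real_iff Im_cinner inner_eq_Re_cinner[symmetric] by blast
qed

text \<open>
  The root constructed above commutes with the complex scalars, as \<open>P\<close> does.  It is the only one: any other
  root \<open>Q\<close> commutes with \<open>P = Q\<^sup>2\<close>, hence with the constructed one.
\<close>

lemma sqrt_operator_properties:
  fixes P :: "'a::complex_hilbert_space \<Rightarrow> 'a"
  assumes P: "positive_operator P"
  shows sqrt_operator_positive: "positive_operator (sqrt_operator P)"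
    and sqrt_operator_square: "sqrt_operator P (sqrt_operator P x) = P x"
proof -
  have PP: "positive_selfadjoint P" and PC: "\<And>a x. P (a *\<^sub>C x) = a *\<^sub>C P x"
    using P by (auto simp: positive_operator_iff)
  obtain S where S: "positive_selfadjoint S" "\<And>x. S (S x) = P x"
    and comm: "\<And>U x. bounded_linear U \<Longrightarrow> (\<And>x. U (P x) = P (U x)) \<Longrightarrow> U (S x) = S (U x)"
    using positive_selfadjoint_sqrt_exists[OF PP] by metis
  have "S (a *\<^sub>C x) = a *\<^sub>C S x" for a x
    using comm[OF bounded_linear_scaleC, of a x] PC by simp
  then have S': "positive_operator S" using S(1) by (simp add: positive_operator_iff)
  have "\<exists>!S. positive_operator S \<and> S \<circ> S = P"
  proof (rule ex1I[of _ S])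
    show "positive_operator S \<and> S \<circ> S = P" using S' S(2) by auto
    fix Q assume Q: "positive_operator Q \<and> Q \<circ> Q = P"
    then have QQ: "\<And>x. Q (Q x) = P x" and pQ: "positive_selfadjoint Q"
      by (auto simp: positive_operator_iff)
    have lQ: "bounded_linear Q" using pQ by (simp add: positive_selfadjoint_def selfadjoint_def)
    have "Q (S x) = S (Q x)" for x by (rule comm[OF lQ]) (simp flip: QQ)
    then show "Q = S" using commuting_square_roots_equal[OF pQ S(1)] QQ S(2) by simp
  qed
  from theI'[OF this] show "positive_operator (sqrt_operator P)" "sqrt_operator P (sqrt_operator P x) = P x"
    unfolding sqrt_operator_def[symmetric] by (auto simp: fun_eq_iff)
qed

lemma abs_operator_properties:
  fixes T :: "'a::complex_hilbert_space \<Rightarrow> 'a"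
  assumes T: "T \<in> bounded_operators"
  shows abs_operator_positive: "positive_operator (abs_operator T)"
    and abs_operator_inner: "abs_operator T (abs_operator T x) \<bullet> y = T x \<bullet> T y"
proof -
  have inner: "(cadjoint T \<circ> T) x \<bullet> y = T x \<bullet> T y" for x y
    using cadjoint_inner[OF T, of y "T x"] by (simp add: inner_commute)
  have "bounded_linear (cadjoint T \<circ> T)"
    using T cadjoint_bounded[OF T] unfolding bounded_operators_iff o_def
    by (blast intro: bounded_linear_compose)
  then have P: "positive_operator (cadjoint T \<circ> T)"
    using T cadjoint_bounded[OF T] inner
    by (simp add: positive_operator_iff positive_selfadjoint_def selfadjoint_def bounded_operators_iff)
      (simp add: inner_commute)
  show "positive_operator (abs_operator T)"
    unfolding abs_operator_def by (rule sqrt_operator_positive[OF P])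
  show "abs_operator T (abs_operator T x) \<bullet> y = T x \<bullet> T y"
    unfolding abs_operator_def sqrt_operator_square[OF P] by (rule inner)
qed

lemma compact_operator_imp_compact_map:
  assumes "compact_operator K"
  shows "compact_map K"
  unfolding compact_map_def
proof (intro allI impI)
  fix x :: "nat \<Rightarrow> 'a" assume x: "\<forall>n. norm (x n) \<le> 1"
  have "seq_compact (closure (K ` cball 0 1))"
    using assms by (simp add: compact_operator_def compact_imp_seq_compact)
  moreover have "\<forall>n. K (x n) \<in> closure (K ` cball 0 1)"
    using x by (auto intro!: closure_subset[THEN subsetD])
  ultimately obtain l r where "strict_mono (r :: nat \<Rightarrow> nat)" "((\<lambda>n. K (x n)) \<circ> r) \<longlonglongrightarrow> l"
    unfolding seq_compact_def by metis
  then show "\<exists>r :: nat \<Rightarrow> nat. strict_mono r \<and> Cauchy (\<lambda>n. K (x (r n)))"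
    using LIMSEQ_imp_Cauchy unfolding o_def by blast
qed

lemma point_spectrum_negative:
  assumes L: "bounded_linear L"
  shows "point_spectrum L \<inter> complex_of_real ` {..<0} = complex_of_real ` negative_eigenvalues_on L UNIV"
proof -
  interpret L: bounded_linear L by (rule L)
  have "complex_of_real l \<in> point_spectrum L \<longleftrightarrow> (\<exists>x. x \<noteq> 0 \<and> L x = l *\<^sub>R x)" for l
  proof -
    have "linear (\<lambda>x. L x - l *\<^sub>R x)"
      by (intro linear_compose_sub L.linear_axioms linear_scaleR)
    from linear_injective_0[OF this] show ?thesis
      by (auto simp: point_spectrum_def simp flip: scaleR_eq_scaleC)
  qed
  then show ?thesis by (auto simp: negative_eigenvalues_on_def)
qed

section \<open>Norm attainment on reducing subspaces\<close>

lemma csubspace_orth_complement: "csubspace (orth_complement N)"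
proof -
  have "cinner 0 y = 0" for y :: 'a using cinner_scaleC_left[of 0 "0::'a" y] by simp
  then show ?thesis
    by (simp add: complex_vector.subspace_def orth_complement_def cinner_add_left cinner_scaleC_left)
qed

lemma closed_orth_complement: "closed (orth_complement N)"
proof -
  have "orth_complement N = (\<Inter>y\<in>N. {x. x \<bullet> y = 0} \<inter> {x. x \<bullet> (\<i> *\<^sub>C y) = 0})"
    by (auto simp: orth_complement_def complex_eq_iff Im_cinner simp flip: inner_eq_Re_cinner)
  moreover have "closed {x. x \<bullet> y = 0}" for y :: 'a
    by (intro closed_Collect_eq continuous_intros)
  ultimately show ?thesis by (simp only:) (intro closed_INT ballI closed_Int)
qed

lemma orth_complement_invariant:
  assumes S: "positive_operator S" and N: "S ` N \<subseteq> N"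
  shows "S ` orth_complement N \<subseteq> orth_complement N"
proof -
  have "S \<in> bounded_operators" "\<forall>x y. S x \<bullet> y = x \<bullet> S y"
    using S unfolding positive_operator_iff positive_selfadjoint_def selfadjoint_def bounded_operators_iff
    by blast+
  then have "\<forall>x y. cinner (S x) y = cinner x (S y)" using cinner_eq_iff_inner by blast
  with N show ?thesis by (auto simp: orth_complement_def)
qed

lemma subset_double_orth_complement: "N \<subseteq> orth_complement (orth_complement N)"
proof (unfold orth_complement_def, intro subsetI CollectI ballI)
  fix x y assume "x \<in> N" "y \<in> {x. \<forall>y\<in>N. cinner x y = 0}"
  then show "cinner x y = 0" using cinner_commute[of x y] by simp
qed

lemma orth_complement_disjoint:
  assumes "x \<in> N" "x \<in> orth_complement N"
  shows "x = 0"
  using assms by (auto simp: orth_complement_def) (metis inner_eq_Re_cinner inner_eq_zero_iff zero_complex.sel(1))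

text \<open>
  On unit vectors, \<open>\<parallel>S x\<parallel>\<^sup>2\<close> and the form of \<open>L\<close> differ by the constant \<open>a\<close>, so they have the same maximisers.
\<close>

lemma norm_attaining_on_iff_form:
  assumes S: "bounded_linear S" and L: "bounded_linear L" and M: "subspace M"
    and square: "\<And>x. norm (S x) ^ 2 = a * norm x ^ 2 + L x \<bullet> x"
  shows "norm_attaining_on S M \<longleftrightarrow> (\<exists>x. maximises_form L M x)"
proof -
  interpret S: bounded_linear S by (rule S)
  let ?U = "{y \<in> M. norm y = 1}"
  obtain B where B: "\<And>x. norm (S x) \<le> norm x * B" using S.bounded by blast
  have bdd: "bdd_above ((\<lambda>y. norm (S y)) ` ?U)"
  proof (rule bdd_aboveI2)
    fix y assume "y \<in> ?U" then show "norm (S y) \<le> B" using B[of y] by simp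
  qed
  have compare: "norm (S y) \<le> norm (S x) \<longleftrightarrow> L y \<bullet> y \<le> L x \<bullet> x" if "norm x = 1" "norm y = 1" for x y
    using square[of x] square[of y] that power_mono_iff[of "norm (S y)" "norm (S x)" 2] by simp
  have "norm_attaining_on S M \<longleftrightarrow> (\<exists>x\<in>?U. \<forall>y\<in>?U. norm (S y) \<le> norm (S x))"
  proof
    assume "norm_attaining_on S M"
    then obtain x where x: "x \<in> M" "norm x = 1" "norm (S x) = (SUP y\<in>?U. norm (S y))"
      by (auto simp: norm_attaining_on_def restriction_norm_def)
    then show "\<exists>x\<in>?U. \<forall>y\<in>?U. norm (S y) \<le> norm (S x)"
      using cSUP_upper[OF _ bdd] by (intro bexI[of _ x]) auto
  next
    assume "\<exists>x\<in>?U. \<forall>y\<in>?U. norm (S y) \<le> norm (S x)"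
    then obtain x where x: "x \<in> ?U" "\<forall>y\<in>?U. norm (S y) \<le> norm (S x)" by blast
    have "restriction_norm S M = norm (S x)"
      unfolding restriction_norm_def by (rule cSup_eq_maximum) (use x in auto)
    with x show "norm_attaining_on S M" by (auto simp: norm_attaining_on_def)
  qed
  also have "\<dots> \<longleftrightarrow> (\<exists>x. maximises_form L M x)"
  proof
    assume "\<exists>x\<in>?U. \<forall>y\<in>?U. norm (S y) \<le> norm (S x)"
    then obtain x where x: "x \<in> M" "norm x = 1" "\<And>y. y \<in> M \<Longrightarrow> norm y = 1 \<Longrightarrow> L y \<bullet> y \<le> L x \<bullet> x"
      using compare by blast
    then show "\<exists>x. maximises_form L M x"
      using form_bound_of_unit_bound[OF L M x(3)] by (auto simp: maximises_form_def)
  next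
    assume "\<exists>x. maximises_form L M x"
    then obtain x where "x \<in> ?U" "\<forall>y\<in>M. L y \<bullet> y \<le> (L x \<bullet> x) * norm y ^ 2"
      by (auto simp: maximises_form_def)
    then show "\<exists>x\<in>?U. \<forall>y\<in>?U. norm (S y) \<le> norm (S x)"
      using compare by (intro bexI[of _ x]) auto
  qed
  finally show ?thesis .
qed

text \<open>
  A reducing subspace of \<open>S\<close> is invariant under \<open>L = S\<^sup>2 - a\<close>, so if the negative eigenvalues are finite in
  number, \<open>form_maximum_attained\<close> applies to it.  Otherwise the eigenvectors for negative eigenvalues generate
  a reducing subspace of \<open>S\<close> without a maximiser: the supremum of the form is at least \<open>0\<close> there, but an
  eigenvector for a non-negative eigenvalue is orthogonal to the generators.
\<close>

lemma beta_iff_finite_negative_eigenvalues: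
  fixes S L :: "'a::complex_hilbert_space \<Rightarrow> 'a"
  assumes S: "positive_operator S" and square: "\<And>x. S (S x) = a *\<^sub>R x + L x"
    and L: "selfadjoint L" and cL: "compact_map L"
  shows "S \<in> beta \<longleftrightarrow> finite (negative_eigenvalues_on L UNIV)"
proof -
  have Sb: "S \<in> bounded_operators" and sS: "selfadjoint S" and SC: "\<And>b x. S (b *\<^sub>C x) = b *\<^sub>C S x"
    using S by (auto simp: positive_operator_iff positive_selfadjoint_def selfadjoint_def bounded_operators_iff)
  have bS: "bounded_linear S" and bL: "bounded_linear L"
    using sS L by (auto simp: selfadjoint_def)
  interpret S: bounded_linear S by (rule bS)
  interpret L: bounded_linear L by (rule bL)
  have L_eq: "L x = S (S x) - a *\<^sub>R x" for x by (simp add: square)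
  have "norm (S x) ^ 2 = a * norm x ^ 2 + L x \<bullet> x" for x
  proof -
    have "norm (S x) ^ 2 = S (S x) \<bullet> x"
      using selfadjoint_inner[OF sS, of "S x" x] by (simp add: power2_norm_eq_inner)
    then show ?thesis by (simp add: square inner_add_left power2_norm_eq_inner)
  qed
  note attain = norm_attaining_on_iff_form[OF bS bL _ this]
  have invariant: "L ` M \<subseteq> M" if "csubspace M" "S ` M \<subseteq> M" for M
    using that csubspace_imp_subspace[OF that(1)] by (auto simp: L_eq intro!: subspace_diff subspace_scale)
  show ?thesis
  proof
    assume fin: "finite (negative_eigenvalues_on L UNIV)"
    have "norm_attaining_on S M" if M: "M \<in> reducing_subspaces S" "M \<noteq> {0}" for M
    proof -
      have cM: "csubspace M" "closed M" "S ` M \<subseteq> M" using M(1) by (auto simp: reducing_subspaces_def)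
      have sM: "subspace M" using cM(1) by (rule csubspace_imp_subspace)
      have "finite (negative_eigenvalues_on L M)"
        by (rule finite_subset[OF _ fin]) (auto simp: negative_eigenvalues_on_def)
      then have "\<exists>x. maximises_form L M x"
        by (rule form_maximum_attained[OF L cL sM cM(2) invariant[OF cM(1,3)] M(2)])
      then show ?thesis using attain[OF sM] by blast
    qed
    then show "S \<in> beta" using Sb by (simp add: beta_def)
  next
    assume "S \<in> beta"
    show "finite (negative_eigenvalues_on L UNIV)"
    proof (rule ccontr)
      assume inf: "infinite (negative_eigenvalues_on L UNIV)"
      define E where "E = {x. \<exists>l<0. L x = l *\<^sub>R x}"
      \<comment> \<open>This is the closed linear span of \<open>E\<close>; as a complement it is a closed subspace at once.\<close>
      define M where "M = orth_complement (orth_complement E)"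
      have EM: "E \<subseteq> M" unfolding M_def by (rule subset_double_orth_complement)
      \<comment> \<open>\<open>S\<close> commutes with \<open>L = S\<^sup>2 - a\<close>, so it preserves the eigenspaces of \<open>L\<close>.\<close>
      have "L (S x) = S (L x)" for x by (simp add: L_eq S.diff S.scaleR)
      then have SE: "S ` E \<subseteq> E" by (auto simp: E_def S.scaleR)
      have SM: "S ` M \<subseteq> M" unfolding M_def by (intro orth_complement_invariant[OF S] SE)
      have cM: "csubspace M" unfolding M_def by (rule csubspace_orth_complement)
      have sM: "subspace M" using cM by (rule csubspace_imp_subspace)
      have "M \<in> reducing_subspaces S"
        using SM orth_complement_invariant[OF S SM] cM closed_orth_complement
        by (auto simp: reducing_subspaces_def M_def)
      moreover have "M \<noteq> {0}"
      proof -
        obtain l where "l \<in> negative_eigenvalues_on L UNIV" using inf by fastforce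
        then obtain e where "e \<in> E" "e \<noteq> 0" by (auto simp: negative_eigenvalues_on_def E_def)
        then show ?thesis using EM by blast
      qed
      ultimately have "norm_attaining_on S M" using \<open>S \<in> beta\<close> by (auto simp: beta_def)
      then obtain x where x: "maximises_form L M x" using attain[OF sM] by blast
      define s where "s = L x \<bullet> x"
      have Lx: "L x = s *\<^sub>R x"
        unfolding s_def by (rule maximises_form_eigenvector[OF L sM invariant[OF cM SM] x])
      \<comment> \<open>\<open>s\<close> is at least as large as every negative eigenvalue, and these accumulate at \<open>0\<close>.\<close>
      have "0 \<le> s"
      proof (rule ccontr)
        assume "\<not> 0 \<le> s"
        then obtain l where l: "l \<in> negative_eigenvalues_on L UNIV" "s < l"
          using negative_eigenvalues_accumulate_at_zero[OF L cL order_refl inf, of "- s"] by auto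
        then obtain e where e: "e \<noteq> 0" "L e = l *\<^sub>R e" "l < 0" by (auto simp: negative_eigenvalues_on_def)
        then have "e \<in> M" using EM by (auto simp: E_def)
        then have "l * (e \<bullet> e) \<le> s * (e \<bullet> e)"
          using x e(2) by (auto simp: maximises_form_def s_def power2_norm_eq_inner dest!: bspec[of _ _ e])
        with l(2) e(1) show False by (simp add: mult_le_cancel_right)
      qed
      have "x \<in> orth_complement E"
      proof -
        have "x \<bullet> y = 0" if "y \<in> E" for y
          using that eigenvectors_orthogonal[OF L Lx] \<open>0 \<le> s\<close> by (fastforce simp: E_def)
        \<comment> \<open>Orthogonality to \<open>\<i> y\<close> makes the imaginary part of \<open>cinner x y\<close> vanish.\<close>
        moreover have "\<i> *\<^sub>C y \<in> E" if y: "y \<in> E" for y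
        proof -
          obtain l where "l < 0" "L y = l *\<^sub>R y" using y by (auto simp: E_def)
          moreover have "L (\<i> *\<^sub>C y) = \<i> *\<^sub>C L y"
            by (simp add: L_eq SC scaleR_eq_scaleC complex_vector.scale_right_diff_distrib scaleC_scaleC mult.commute)
          ultimately have "L (\<i> *\<^sub>C y) = l *\<^sub>R (\<i> *\<^sub>C y)"
            by (simp add: scaleR_eq_scaleC scaleC_scaleC mult.commute)
          with \<open>l < 0\<close> show ?thesis by (auto simp: E_def)
        qed
        ultimately show ?thesis by (auto simp: orth_complement_def complex_eq_iff Im_cinner simp flip: inner_eq_Re_cinner)
      qed
      moreover have "x \<in> M" "norm x = 1" using x by (auto simp: maximises_form_def)
      ultimately show False using orth_complement_disjoint[of x "orth_complement E"] by (auto simp: M_def)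
    qed
  qed
qed

section \<open>Compact perturbations\<close>

theorem theorem5p4:
  fixes T K D R L :: "'a::complex_hilbert_space \<Rightarrow> 'a"
    and c :: real
  assumes infinite_dimensional: "\<not> (\<exists>B :: 'a set. finite B \<and> cspan B = UNIV)"
    and separable: "separable_space (euclidean :: 'a topology)"
    and T: "T \<in> beta0"
    and K: "compact_operator K"
    and c: "c = Inf {r :: real. complex_of_real r \<in> point_spectrum (abs_operator T)}"
    and D: "D = (\<lambda>x. cadjoint T (T x) - complex_of_real (c ^ 2) *\<^sub>C x)"
    and R: "R = (\<lambda>x. cadjoint T (K x) + cadjoint K (T x) + cadjoint K (K x))"
    and L: "L = (\<lambda>x. D x + R x)"
    and D_compact: "compact_operator D"
  shows "(\<lambda>x. T x + K x) \<in> beta0 \<longleftrightarrow>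
         finite (point_spectrum L \<inter> complex_of_real ` {..<0})"
proof -
  have bT: "T \<in> bounded_operators" using T by (simp add: beta0_def)
  have bK: "K \<in> bounded_operators" using K by (simp add: compact_operator_def)
  let ?A = "\<lambda>x. T x + K x"
  have bA: "?A \<in> bounded_operators"
    using bT bK by (simp add: bounded_operators_iff bounded_linear_add scaleC_add_right)
  define S where "S = abs_operator ?A"
  have S: "positive_operator S" unfolding S_def by (rule abs_operator_positive[OF bA])
  then have bS: "bounded_linear S" and sS: "selfadjoint S"
    by (auto simp: positive_operator_iff positive_selfadjoint_def selfadjoint_def)
  have adjT: "cadjoint T u \<bullet> y = u \<bullet> T y" and adjK: "cadjoint K u \<bullet> y = u \<bullet> K y" for u y
    using cadjoint_inner[OF bT, of y u] cadjoint_inner[OF bK, of y u] by (simp_all add: inner_commute)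
  have square: "S (S x) = c ^ 2 *\<^sub>R x + L x" for x
  proof -
    have "S (S x) \<bullet> y = (c ^ 2 *\<^sub>R x + L x) \<bullet> y" for y
    proof -
      have "S (S x) \<bullet> y = ?A x \<bullet> ?A y" unfolding S_def by (rule abs_operator_inner[OF bA])
      then show ?thesis
        by (simp add: L D R adjT adjK inner_add_left inner_add_right inner_diff_left
              flip: scaleR_eq_scaleC of_real_power)
    qed
    then show ?thesis using vector_eq_rdot by blast
  qed
  have L_eq: "L = (\<lambda>x. S (S x) - c ^ 2 *\<^sub>R x)" by (simp add: square)
  have "bounded_linear L"
    unfolding L_eq
    by (intro bounded_linear_sub bounded_linear_compose[OF bS bS] bounded_linear_scaleR_right)
  then have sL: "selfadjoint L"
    by (simp add: selfadjoint_def L_eq inner_diff_left inner_diff_right selfadjoint_inner[OF sS])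
  have cL: "compact_map L"
  proof -
    have lin: "bounded_linear T" "bounded_linear K" "bounded_linear (cadjoint T)" "bounded_linear (cadjoint K)"
      using bT bK cadjoint_bounded[OF bT] cadjoint_bounded[OF bK] by (simp_all add: bounded_operators_iff)
    have cK: "compact_map K" by (rule compact_operator_imp_compact_map[OF K])
    have cK': "compact_map (cadjoint K)"
      by (rule compact_map_adjoint[OF cK lin(2,4) cadjoint_inner[OF bK]])
    show ?thesis unfolding L R
      by (intro compact_map_add compact_operator_imp_compact_map[OF D_compact]
          compact_map_compose_left[OF lin(3) cK] compact_map_compose_left[OF lin(4) cK]
          compact_map_compose_right[OF cK' lin(4,1)])
  qed
  have "?A \<in> beta0 \<longleftrightarrow> S \<in> beta" using bA by (simp add: beta0_def S_def)
  also have "\<dots> \<longleftrightarrow> finite (negative_eigenvalues_on L UNIV)"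
    by (rule beta_iff_finite_negative_eigenvalues[OF S square sL cL])
  also have "\<dots> \<longleftrightarrow> finite (point_spectrum L \<inter> complex_of_real ` {..<0})"
    unfolding point_spectrum_negative[OF selfadjoint_bounded_linear[OF sL]]
    by (simp add: finite_image_iff inj_on_def)
  finally show ?thesis .
qed

end
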